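(* Let $n\ge1$, let $\Omega\subset\mathbb{R}^n$ be a bounded domain with Lipschitz boundary, $\Omega_e:=\mathbb{R}^n\setminus\overline\Omega$, $s\in(0,1)$, and let $W_2\subset\Omega_e$ be a nonempty open set. For $j=1,2$ let $F_j\in(\widetilde H^s(\Omega))^*$ and let $u_j^{(0)}\in H^s(\mathbb{R}^n)$ be the unique solution of \[ \begin{cases}(-\Delta)^s u_j^{(0)}=F_j & \text{in }\Omega,\\ u_j^{(0)}=0 & \text{in }\Omega_e.\end{cases} \] If $(-\Delta)^s u_1^{(0)}=(-\Delta)^s u_2^{(0)}$ in $W_2$, then $F_1=F_2$ in $\Omega$.
   Context: $(-\Delta)^s$ denotes the fractional Laplacian on $\mathbb{R}^n$, $(-\Delta)^s u(x)=c_{n,s}\,\mathrm{P.V.}\int_{\mathbb{R}^n}\frac{u(x)-u(y)}{|x-y|^{n+2s}}\,dy$, $c_{n,s}=\frac{\Gamma(\frac n2+s)}{|\Gamma(-s)|}\frac{4^s}{\pi^{n/2}}$ (understood in the distributional/Fourier sense for $H^s$ functions). $\widetilde H^s(\Omega)$ is the closure of $C_c^\infty(\Omega)$ in $H^s(\mathbb{R}^n)$. *)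

theory Defs
  imports "HOL-Analysis.Analysis"
begin

text \<open>C-infinity: f lies in a class of everywhere-differentiable functions that is
  closed under taking partial derivatives along the basis vectors
  (equivalently: all iterated partial derivatives exist and are differentiable).\<close>
definition smooth_fun :: "('a::euclidean_space \<Rightarrow> real) \<Rightarrow> bool" where
  "smooth_fun f \<longleftrightarrow>
     (\<exists>S. f \<in> S \<and>
        (\<forall>g\<in>S. (\<forall>x. g differentiable (at x)) \<and>
               (\<forall>b\<in>Basis. (\<lambda>x. frechet_derivative g (at x) b) \<in> S)))"

definition test_fun :: "'a::euclidean_space set \<Rightarrow> ('a \<Rightarrow> real) \<Rightarrow> bool" where
  "test_fun U \<phi> \<longleftrightarrow> smooth_fun \<phi> \<and>
     (\<exists>K. compact K \<and> K \<subseteq> U \<and> (\<forall>x. x \<notin> K \<longrightarrow> \<phi> x = 0))"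

definition lipschitz_boundary :: "'a::euclidean_space set \<Rightarrow> bool" where
  "lipschitz_boundary \<Omega> \<longleftrightarrow>
     (\<forall>p\<in>frontier \<Omega>. \<exists>e r h L g.
        norm e = 1 \<and> r > 0 \<and> h > 0 \<and>
        L-lipschitz_on {x. x \<bullet> e = 0} g \<and>
        (let proj = (\<lambda>x. x - (x \<bullet> e) *\<^sub>R e);
             C = {x. norm (proj x - proj p) < r \<and> \<bar>(x - p) \<bullet> e\<bar> < h}
         in \<Omega> \<inter> C = {x\<in>C. x \<bullet> e < g (proj x)}))"

definition bounded_lipschitz_domain :: "'a::euclidean_space set \<Rightarrow> bool" where
  "bounded_lipschitz_domain \<Omega> \<longleftrightarrow>
     open \<Omega> \<and> connected \<Omega> \<and> \<Omega> \<noteq> {} \<and> bounded \<Omega> \<and> lipschitz_boundary \<Omega>"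

definition L2_norm_sq :: "('a::euclidean_space \<Rightarrow> real) \<Rightarrow> real" where
  "L2_norm_sq u = (\<integral>x. (u x)\<^sup>2 \<partial>lborel)"

definition gagliardo_sq :: "real \<Rightarrow> ('a::euclidean_space \<Rightarrow> real) \<Rightarrow> real" where
  "gagliardo_sq s u =
     (\<integral>z. (u (fst z) - u (snd z))\<^sup>2 / dist (fst z) (snd z) powr (real DIM('a) + 2 * s)
        \<partial>(lborel \<Otimes>\<^sub>M lborel))"

definition Hs :: "real \<Rightarrow> ('a::euclidean_space \<Rightarrow> real) set" where
  "Hs s = {u. u \<in> borel_measurable lborel \<and>
              integrable lborel (\<lambda>x. (u x)\<^sup>2) \<and>
              integrable (lborel \<Otimes>\<^sub>M lborel)
                (\<lambda>z. (u (fst z) - u (snd z))\<^sup>2 / dist (fst z) (snd z) powr (real DIM('a) + 2 * s))}"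

definition Hs_norm :: "real \<Rightarrow> ('a::euclidean_space \<Rightarrow> real) \<Rightarrow> real" where
  "Hs_norm s u = sqrt (L2_norm_sq u + gagliardo_sq s u)"

definition Hs_tilde :: "real \<Rightarrow> 'a::euclidean_space set \<Rightarrow> ('a \<Rightarrow> real) set" where
  "Hs_tilde s \<Omega> = {u \<in> Hs s. \<forall>\<epsilon>>0. \<exists>\<phi>. test_fun \<Omega> \<phi> \<and> Hs_norm s (\<lambda>x. u x - \<phi> x) < \<epsilon>}"

definition Hs_tilde_dual :: "real \<Rightarrow> 'a::euclidean_space set \<Rightarrow> (('a \<Rightarrow> real) \<Rightarrow> real) set" where
  "Hs_tilde_dual s \<Omega> = {F.
     (\<forall>u\<in>Hs_tilde s \<Omega>. \<forall>v\<in>Hs_tilde s \<Omega>. \<forall>a b::real.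
         F (\<lambda>x. a * u x + b * v x) = a * F u + b * F v) \<and>
     (\<exists>C. \<forall>u\<in>Hs_tilde s \<Omega>. \<bar>F u\<bar> \<le> C * Hs_norm s u)}"

definition frac_const :: "nat \<Rightarrow> real \<Rightarrow> real" where
  "frac_const n s = Gamma (real n / 2 + s) / \<bar>Gamma (- s)\<bar> * (4 powr s / pi powr (real n / 2))"

definition frac_lap :: "real \<Rightarrow> ('a::euclidean_space \<Rightarrow> real) \<Rightarrow> 'a \<Rightarrow> real" where
  "frac_lap s \<phi> x = frac_const DIM('a) s *
     Lim (at_right 0) (\<lambda>\<epsilon>. \<integral>y. indicator {y. \<epsilon> \<le> dist x y} y *
            ((\<phi> x - \<phi> y) / dist x y powr (real DIM('a) + 2 * s)) \<partial>lborel)"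

text \<open>Distributional action of \<open>(-\<Delta>)^s u\<close> on a test function \<phi>:
  \<open>\<langle>(-\<Delta>)^s u, \<phi>\<rangle> = \<integral> u (-\<Delta>)^s \<phi>\<close>.\<close>
definition frac_lap_pair :: "real \<Rightarrow> ('a::euclidean_space \<Rightarrow> real) \<Rightarrow> ('a \<Rightarrow> real) \<Rightarrow> real" where
  "frac_lap_pair s u \<phi> = (\<integral>x. u x * frac_lap s \<phi> x \<partial>lborel)"

end

theory Submission
  imports Defs
begin

text \<open>
  The difference \<open>w = u1 - u2\<close> vanishes almost everywhere off the compact set \<open>K = closure \<Omega>\<close>, so on
  \<open>W2\<close> its fractional Laplacian is, up to a non-zero constant, the Riesz-type potential
  \<open>\<integral> w(y) |x - y|^(-n-2s) dy\<close>, which therefore vanishes for \<open>x \<in> W2\<close>. Since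
  \<open>\<Delta> |x|^(-2\<beta>) = 2\<beta> (2\<beta> + 2 - n) |x|^(-2\<beta>-2)\<close> and the factor is non-zero for \<open>2\<beta> \<ge> n + 2s\<close>, the
  potentials with exponents \<open>-n-2s-2k\<close> vanish there as well. By Weierstrass approximation in the
  variable \<open>|x - y|^(-2)\<close>, \<open>w\<close> annihilates every continuous radial function about \<open>x\<close>, in particular
  \<open>exp (-|x - y|^2)\<close>. Differentiating in \<open>x\<close> gives \<open>\<integral> w(y) exp (-|x - y|^2) p(y) dy = 0\<close> for all
  polynomials \<open>p\<close>, and Stone-Weierstrass yields \<open>w = 0\<close> almost everywhere. Hence \<open>F1\<close> and \<open>F2\<close> agree
  on test functions, which are dense. This elementary route, available because \<open>w\<close> has compact
  support, replaces the general unique continuation property of the fractional Laplacian.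
\<close>

section \<open>Integrals against a compactly supported density\<close>

text \<open>The obstacle is how little is known about \<open>frac_lap s \<phi>\<close>: it is
  defined through a limit whose existence on the support of \<open>\<phi>\<close> is never
  established. Two facts carry the proof. The function is measurable, so \<open>u\<close> may be
  exchanged for any measurable function equal to it almost everywhere; and off the support of
  \<open>\<phi>\<close> it is an ordinary integral. A density living on \<open>K\<close>, tested
  with \<open>\<phi>\<close> supported in \<open>W2\<close>, only sees the second situation. For
  \<open>x\<close> in \<open>W2\<close> the kernels are smooth in \<open>x\<close> and bounded for
  \<open>y\<close> in \<open>K\<close>, so an integrable density is enough for differentiation and
  approximation under the integral. All exponents \<open>-n-2s-2k\<close> share the factor
  \<open>|x - y|^(-n-2s)\<close>, which has no zero on \<open>K\<close> and can be split off before
  approximating by polynomials in \<open>|x - y|^(-2)\<close>. The Gaussian is chosen because every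
  derivative in \<open>x\<close> produces a factor linear in \<open>y\<close>, and because it is
  positive and can be divided out.\<close>

locale compact_density =
  fixes w :: "'a::euclidean_space \<Rightarrow> real" and K :: "'a set"
  assumes compact_K: "compact K"
    and integrable_w: "integrable lborel w"
    and w_outside: "\<And>y. y \<notin> K \<Longrightarrow> w y = 0"
begin

text \<open>Only the values on \<open>K\<close> matter, so kernels that are singular somewhere off
  \<open>K\<close> are legitimate arguments.\<close>

definition pairing :: "('a \<Rightarrow> real) \<Rightarrow> real" where
  "pairing f = (\<integral>y. w y * f y \<partial>lborel)"

lemma pairing_cong: "(\<And>y. y \<in> K \<Longrightarrow> f y = g y) \<Longrightarrow> pairing f = pairing g"
  unfolding pairing_def using w_outside by (intro Bochner_Integration.integral_cong) auto

lemma mult_indicator: "w y * (indicator K y * f y) = w y * f y"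
  using w_outside[of y] by (auto simp: indicator_def)

text \<open>Off \<open>K\<close> nothing is known of \<open>f\<close>, not even measurability. As
  \<open>w\<close> vanishes there, \<open>f\<close> may be multiplied by the indicator of
  \<open>K\<close>, which makes it Borel.\<close>

lemma measurable_pairing:
  assumes "continuous_on K f"
  shows "(\<lambda>y. w y * f y) \<in> borel_measurable borel"
proof -
  have K: "K \<in> sets borel"
    using compact_K by (intro borel_closed compact_imp_closed)
  have "(\<lambda>y. indicator K y *\<^sub>R f y) \<in> borel_measurable borel"
    using assms K by (rule borel_measurable_continuous_on_indicator[rotated])
  then have "(\<lambda>y. w y * (indicator K y * f y)) \<in> borel_measurable borel"
    using borel_measurable_integrable[OF integrable_w] by (simp add: borel_measurable_times)
  then show ?thesis by (simp add: mult_indicator)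
qed

lemma integrable_pairing_bounded:
  assumes "(\<lambda>y. w y * f y) \<in> borel_measurable borel" and B: "\<And>y. y \<in> K \<Longrightarrow> \<bar>f y\<bar> \<le> B"
  shows "integrable lborel (\<lambda>y. w y * f y)"
proof (rule Bochner_Integration.integrable_bound)
  show "integrable lborel (\<lambda>y. B * w y)" using integrable_w by simp
  show "(\<lambda>y. w y * f y) \<in> borel_measurable lborel" using assms by simp
  show "AE y in lborel. norm (w y * f y) \<le> norm (B * w y)"
  proof (intro AE_I2)
    fix y
    show "norm (w y * f y) \<le> norm (B * w y)"
    proof (cases "y \<in> K")
      case True
      have "\<bar>f y\<bar> * \<bar>w y\<bar> \<le> \<bar>B\<bar> * \<bar>w y\<bar>"
        using B[OF True] by (intro mult_right_mono) auto
      then show ?thesis by (simp add: abs_mult mult.commute)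
    qed (simp add: w_outside)
  qed
qed

lemma integrable_pairing:
  assumes "continuous_on K f"
  shows "integrable lborel (\<lambda>y. w y * f y)"
proof -
  have "bounded (f ` K)"
    using assms compact_K by (intro compact_imp_bounded compact_continuous_image)
  then obtain B where "\<And>y. y \<in> K \<Longrightarrow> \<bar>f y\<bar> \<le> B"
    unfolding bounded_real by auto
  then show ?thesis by (rule integrable_pairing_bounded[OF measurable_pairing[OF assms]])
qed

section \<open>Linearity and continuity of the pairing\<close>

lemma pairing_add:
  assumes "continuous_on K f" "continuous_on K g"
  shows "pairing (\<lambda>y. f y + g y) = pairing f + pairing g"
  using integrable_pairing[OF assms(1)] integrable_pairing[OF assms(2)]
  by (simp add: pairing_def distrib_left)

lemma pairing_diff:
  assumes "continuous_on K f" "continuous_on K g"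
  shows "pairing (\<lambda>y. f y - g y) = pairing f - pairing g"
  using integrable_pairing[OF assms(1)] integrable_pairing[OF assms(2)]
  by (simp add: pairing_def right_diff_distrib)

lemma pairing_cmult: "pairing (\<lambda>y. c * f y) = c * pairing f"
  by (simp add: pairing_def mult.left_commute)

lemma pairing_sum:
  assumes "\<And>i. i \<in> I \<Longrightarrow> continuous_on K (f i)"
  shows "pairing (\<lambda>y. \<Sum>i\<in>I. f i y) = (\<Sum>i\<in>I. pairing (f i))"
  unfolding pairing_def sum_distrib_left
  by (rule Bochner_Integration.integral_sum) (rule integrable_pairing[OF assms])

lemma pairing_bound:
  assumes "continuous_on K f" "\<And>y. y \<in> K \<Longrightarrow> \<bar>f y\<bar> \<le> e"
  shows "\<bar>pairing f\<bar> \<le> e * (\<integral>y. \<bar>w y\<bar> \<partial>lborel)"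
proof -
  have "\<bar>pairing f\<bar> \<le> (\<integral>y. \<bar>w y * f y\<bar> \<partial>lborel)"
    unfolding pairing_def by (rule integral_abs_bound)
  also have "\<dots> \<le> (\<integral>y. e * \<bar>w y\<bar> \<partial>lborel)"
  proof (rule integral_mono)
    show "integrable lborel (\<lambda>y. \<bar>w y * f y\<bar>)"
      using integrable_pairing[OF assms(1)] by (rule integrable_abs)
    show "integrable lborel (\<lambda>y. e * \<bar>w y\<bar>)" using integrable_w by simp
    show "\<bar>w y * f y\<bar> \<le> e * \<bar>w y\<bar>" for y
      using assms(2)[of y] w_outside[of y]
      by (cases "y \<in> K") (auto simp: abs_mult mult.commute intro!: mult_right_mono)
  qed
  finally show ?thesis by simp
qed

text \<open>The pairing is continuous for the supremum norm on \<open>K\<close>, with the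
  \<open>L^1\<close> norm of \<open>w\<close> as constant. Both Weierstrass arguments below end
  here.\<close>

lemma pairing_eq_0_uniform_limit:
  assumes f: "continuous_on K f"
    and approx: "\<And>e. e > 0 \<Longrightarrow>
      \<exists>p. continuous_on K p \<and> pairing p = 0 \<and> (\<forall>y\<in>K. \<bar>f y - p y\<bar> \<le> e)"
  shows "pairing f = 0"
proof -
  define W where "W = (\<integral>y. \<bar>w y\<bar> \<partial>lborel)"
  have W: "W \<ge> 0" unfolding W_def by simp
  have "\<bar>pairing f\<bar> \<le> e" if "e > 0" for e
  proof -
    \<comment> \<open>The summand 1 covers the case \<open>W = 0\<close>.\<close>
    from W that have "e / (W + 1) > 0" by simp
    from approx[OF this] obtain p where p: "continuous_on K p" "pairing p = 0"
      "\<And>y. y \<in> K \<Longrightarrow> \<bar>f y - p y\<bar> \<le> e / (W + 1)" by blast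
    have "\<bar>pairing (\<lambda>y. f y - p y)\<bar> \<le> e / (W + 1) * W"
      unfolding W_def using p f by (intro pairing_bound continuous_intros) (auto simp: W_def)
    also have "\<dots> \<le> e" using W that by (simp add: field_simps)
    finally show ?thesis using p f by (simp add: pairing_diff)
  qed
  then have "\<bar>pairing f\<bar> \<le> 0" by (rule field_le_epsilon) simp
  then show ?thesis by simp
qed

lemma pairing_dominated_convergence:
  assumes "\<And>n. (\<lambda>y. w y * f n y) \<in> borel_measurable borel" "(\<lambda>y. w y * g y) \<in> borel_measurable borel"
    and lim: "\<And>y. y \<in> K \<Longrightarrow> (\<lambda>n. f n y) \<longlonglongrightarrow> g y"
    and bound: "\<And>n y. y \<in> K \<Longrightarrow> \<bar>f n y\<bar> \<le> B"
  shows "(\<lambda>n. pairing (f n)) \<longlonglongrightarrow> pairing g"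
  unfolding pairing_def
proof (rule integral_dominated_convergence[where w = "\<lambda>y. B * \<bar>w y\<bar>"])
  show "integrable lborel (\<lambda>y. B * \<bar>w y\<bar>)" using integrable_w by simp
  show "(\<lambda>y. w y * g y) \<in> borel_measurable lborel" "(\<lambda>y. w y * f n y) \<in> borel_measurable lborel" for n
    using assms by simp_all
  show "AE y in lborel. (\<lambda>n. w y * f n y) \<longlonglongrightarrow> w y * g y"
  proof (intro AE_I2)
    show "(\<lambda>n. w y * f n y) \<longlonglongrightarrow> w y * g y" for y
      by (cases "y \<in> K") (auto simp: w_outside intro!: tendsto_intros lim)
  qed
  show "AE y in lborel. norm (w y * f n y) \<le> B * \<bar>w y\<bar>" for n
  proof (intro AE_I2)
    show "norm (w y * f n y) \<le> B * \<bar>w y\<bar>" for y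
      using bound[of y n] w_outside[of y]
      by (cases "y \<in> K") (auto simp: abs_mult mult.commute[of B] intro!: mult_left_mono)
  qed
qed

text \<open>Differentiation under the integral sign. By the mean value theorem the difference
  quotients along \<open>b\<close> are values of \<open>k'\<close> on a compact set, hence uniformly
  bounded, and dominated convergence applies. Each quotient pairs to 0 because \<open>W\<close> is
  open and both of its base points lie in \<open>W\<close>.\<close>

lemma pairing_directional_derivative_eq_0:
  fixes k k' :: "'a \<Rightarrow> 'a \<Rightarrow> real"
  assumes W: "open W" and x: "x \<in> W"
    and k: "\<And>x. x \<in> W \<Longrightarrow> continuous_on K (k x)"
    and k': "continuous_on (W \<times> K) (\<lambda>z. k' (fst z) (snd z))"
    and der: "\<And>x y. x \<in> W \<Longrightarrow> y \<in> K \<Longrightarrow>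
      ((\<lambda>t. k (x + t *\<^sub>R b) y) has_real_derivative k' x y) (at 0)"
    and zero: "\<And>x. x \<in> W \<Longrightarrow> pairing (k x) = 0"
  shows "pairing (k' x) = 0"
proof -
  obtain r where r: "r > 0" "cball x r \<subseteq> W"
    using W x open_contains_cball by blast
  have "compact ((\<lambda>z. k' (fst z) (snd z)) ` (cball x r \<times> K))"
    using compact_K r by (intro compact_continuous_image compact_Times continuous_on_subset[OF k']) auto
  then have "bounded ((\<lambda>z. k' (fst z) (snd z)) ` (cball x r \<times> K))"
    by (rule compact_imp_bounded)
  then obtain B where "\<forall>v\<in>(\<lambda>z. k' (fst z) (snd z)) ` (cball x r \<times> K). \<bar>v\<bar> \<le> B"
    unfolding bounded_real by blast
  then have B: "\<bar>k' z y\<bar> \<le> B" if "z \<in> cball x r" "y \<in> K" for z y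
    using that by force
  \<comment> \<open>Keeps the segment from \<open>x\<close> in direction \<open>b\<close> inside
    \<open>cball x r\<close>; the summand 1 allows \<open>b = 0\<close>.\<close>
  define d where "d = r / (norm b + 1)"
  have d: "d > 0" unfolding d_def using r by (simp add: add_nonneg_pos)
  have seg: "x + t *\<^sub>R b \<in> cball x r" if "\<bar>t\<bar> \<le> d" for t
  proof -
    have "\<bar>t\<bar> * norm b \<le> d * (norm b + 1)"
      using that d by (intro mult_mono) auto
    also have "\<dots> = r" unfolding d_def by (simp add: add_nonneg_eq_0_iff)
    finally show ?thesis by (simp add: dist_norm)
  qed
  define t where "t n = d / real (Suc n)" for n
  have t: "0 < t n" "t n \<le> d" for n
    unfolding t_def using d by (auto simp: field_simps)
  have t0: "t \<longlonglongrightarrow> 0"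
    unfolding t_def using LIMSEQ_Suc[OF lim_const_over_n] by simp
  \<comment> \<open>The assumption gives the derivative only at parameter 0; moving the base point
    to \<open>x + u b\<close> gives it along the whole segment, as the mean value theorem
    requires.\<close>
  have der': "((\<lambda>t. k (x + t *\<^sub>R b) y) has_real_derivative k' (x + u *\<^sub>R b) y) (at u)"
    if "\<bar>u\<bar> \<le> d" "y \<in> K" for u y
  proof -
    have "((\<lambda>t. k ((x + u *\<^sub>R b) + t *\<^sub>R b) y) has_real_derivative k' (x + u *\<^sub>R b) y) (at 0)"
      using seg[OF that(1)] r that(2) by (intro der) auto
    then show ?thesis
      using DERIV_shift[of "\<lambda>t. k (x + t *\<^sub>R b) y" "k' (x + u *\<^sub>R b) y" 0 u]
      by (simp add: algebra_simps)
  qed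
  define D where "D n y = (k (x + t n *\<^sub>R b) y - k x y) / t n" for n y
  have "(\<lambda>n. pairing (D n)) \<longlonglongrightarrow> pairing (k' x)"
  proof (rule pairing_dominated_convergence[where B = B])
    show "(\<lambda>y. w y * D n y) \<in> borel_measurable borel" for n
      unfolding D_def using t[of n] seg[of "t n"] r x
      by (intro measurable_pairing continuous_intros k) auto
    show "(\<lambda>y. w y * k' x y) \<in> borel_measurable borel"
      using x by (intro measurable_pairing
          continuous_on_compose2[OF k', of K "\<lambda>y. (x, y)", simplified] continuous_intros) auto
    show "(\<lambda>n. D n y) \<longlonglongrightarrow> k' x y" if "y \<in> K" for y
    proof -
      have "((\<lambda>h. (k (x + h *\<^sub>R b) y - k x y) / h) \<longlongrightarrow> k' x y) (at 0)"
        using der[OF x that] by (simp add: DERIV_def)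
      moreover have "filterlim t (at 0) sequentially"
        using t0 t by (simp add: filterlim_at less_imp_neq[symmetric])
      ultimately show ?thesis
        unfolding D_def by (rule filterlim_compose)
    qed
    show "\<bar>D n y\<bar> \<le> B" if y: "y \<in> K" for n y
    proof -
      obtain z where z: "0 < z" "z < t n"
        "k (x + t n *\<^sub>R b) y - k (x + 0 *\<^sub>R b) y = (t n - 0) * k' (x + z *\<^sub>R b) y"
        using MVT2[of 0 "t n" "\<lambda>t. k (x + t *\<^sub>R b) y" "\<lambda>u. k' (x + u *\<^sub>R b) y"] t[of n] der'[OF _ y]
        by force
      then have "D n y = k' (x + z *\<^sub>R b) y"
        unfolding D_def by simp
      then show ?thesis using B[OF seg y, of z] z t[of n] by simp
    qed
  qed
  moreover have "pairing (D n) = 0" for n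
  proof -
    have xt: "x + t n *\<^sub>R b \<in> W" using seg[of "t n"] t[of n] r by auto
    have "pairing (D n) = inverse (t n) * pairing (\<lambda>y. k (x + t n *\<^sub>R b) y - k x y)"
      unfolding pairing_cmult[symmetric] D_def by (simp add: divide_inverse mult.commute)
    then show ?thesis using xt x by (simp add: pairing_diff k zero)
  qed
  ultimately show ?thesis by (simp add: LIMSEQ_const_iff)
qed

text \<open>Applies the Laplacian in \<open>x\<close> under the integral: two directional
  derivatives for each basis vector, summed over the basis. The condition on \<open>\<beta>\<close>
  keeps the resulting factor away from 0, so it can be cancelled.\<close>

lemma pairing_inverse_power_step:
  fixes W :: "'a set"
  assumes W: "open W" "W \<inter> K = {}"
    and \<beta>: "\<beta> > 0" "2 * \<beta> + 2 \<noteq> real DIM('a)"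
    and zero: "\<And>x. x \<in> W \<Longrightarrow> pairing (\<lambda>y. ((x - y) \<bullet> (x - y)) powr (- \<beta>)) = 0"
    and x: "x \<in> W"
  shows "pairing (\<lambda>y. ((x - y) \<bullet> (x - y)) powr (- \<beta> - 1)) = 0"
proof -
  define q where "q x y = (x - y) \<bullet> (x - y)" for x y :: 'a
  \<comment> \<open>\<open>k1 b\<close> and \<open>k2 b\<close> are the first and second derivatives
    of \<open>q x y powr (- \<beta>)\<close> in \<open>x\<close> along \<open>b\<close>; in
    \<open>k2\<close> the relation \<open>b \<bullet> b = 1\<close> for a basis vector is already
    inserted.\<close>
  define k1 where "k1 b x y = - \<beta> * q x y powr (- \<beta> - 1) * (2 * ((x - y) \<bullet> b))" for b x y :: 'a
  define k2 where "k2 b x y = - \<beta> * ((- \<beta> - 1) * q x y powr (- \<beta> - 2) * (2 * ((x - y) \<bullet> b))) * (2 * ((x - y) \<bullet> b))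
    - \<beta> * q x y powr (- \<beta> - 1) * 2" for b x y :: 'a
  have q: "q x y > 0" if "x \<in> W" "y \<in> K" for x y
    using that W unfolding q_def by auto
  have q_cont: "continuous_on S (\<lambda>z. q (f z) (g z))" 
    if "continuous_on S f" "continuous_on S g" for S :: "('a \<times> 'a) set" and f g
    unfolding q_def using that by (intro continuous_intros)
  have q_cont': "continuous_on K (\<lambda>y. q x y)" for x
    unfolding q_def by (intro continuous_intros)
  have q_der: "((\<lambda>t. q (x + t *\<^sub>R b) y) has_real_derivative 2 * ((x - y) \<bullet> b)) (at 0)" for x y b
  proof -
    have "q (x + t *\<^sub>R b) y = q x y + t * (2 * ((x - y) \<bullet> b)) + t * t * (b \<bullet> b)" for t
      unfolding q_def by (simp add: algebra_simps inner_commute)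
    then show ?thesis by (auto intro!: derivative_eq_intros)
  qed
  have p_der: "((\<lambda>t. q (x + t *\<^sub>R b) y powr r) has_real_derivative 
      r * q x y powr (r - 1) * (2 * ((x - y) \<bullet> b))) (at 0)" if "x \<in> W" "y \<in> K" for x y b r
  proof -
    have "((\<lambda>t. q (x + t *\<^sub>R b) y powr r) has_real_derivative 
      r * q (x + 0 *\<^sub>R b) y powr (r - of_nat 1) * (2 * ((x - y) \<bullet> b))) (at 0)"
      using q[OF that] by (intro DERIV_fun_powr q_der) auto
    then show ?thesis by simp
  qed
  have z1: "pairing (k1 b x) = 0" if x: "x \<in> W" for b x
  proof (rule pairing_directional_derivative_eq_0[OF W(1) x, where b = b and k = "\<lambda>x y. q x y powr (- \<beta>)"])
    show "continuous_on K (\<lambda>y. q x y powr - \<beta>)" if "x \<in> W" for x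
      using q[OF that] by (intro continuous_intros q_cont') force
    show "continuous_on (W \<times> K) (\<lambda>z. k1 b (fst z) (snd z))"
      unfolding k1_def using q by (intro continuous_intros q_cont) force+
    show "((\<lambda>t. q (x + t *\<^sub>R b) y powr - \<beta>) has_real_derivative k1 b x y) (at 0)"
      if "x \<in> W" "y \<in> K" for x y
      using p_der[OF that, of b "- \<beta>"] unfolding k1_def by simp
    show "pairing (\<lambda>y. q x y powr - \<beta>) = 0" if "x \<in> W" for x
      using zero[OF that] unfolding q_def by simp
  qed
  have cont2: "continuous_on (W \<times> K) (\<lambda>z. k2 b (fst z) (snd z))" for b
    unfolding k2_def using q by (intro continuous_intros q_cont) force+
  have z2: "pairing (k2 b x) = 0" if b: "b \<in> Basis" for b
  proof (rule pairing_directional_derivative_eq_0[OF W(1) x, where b = b and k = "k1 b"])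
    show "continuous_on K (k1 b x)" if "x \<in> W" for x
      unfolding k1_def using q[OF that] by (intro continuous_intros q_cont') force
    show "continuous_on (W \<times> K) (\<lambda>z. k2 b (fst z) (snd z))" by (rule cont2)
    show "((\<lambda>t. k1 b (x + t *\<^sub>R b) y) has_real_derivative k2 b x y) (at 0)"
      if "x \<in> W" "y \<in> K" for x y
    proof -
      have "(x + t *\<^sub>R b - y) \<bullet> b = (x - y) \<bullet> b + t * (b \<bullet> b)" for t
        by (simp add: algebra_simps)
      then have "((\<lambda>t. 2 * ((x + t *\<^sub>R b - y) \<bullet> b)) has_real_derivative 2 * (b \<bullet> b)) (at 0)"
        by (auto intro!: derivative_eq_intros)
      from DERIV_mult[OF DERIV_cmult[OF p_der[OF that, of b "- \<beta> - 1"], of "- \<beta>"] this]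
      show ?thesis
        using b unfolding k1_def k2_def by (simp add: algebra_simps inner_same_Basis)
    qed
    show "pairing (k1 b x) = 0" if "x \<in> W" for x by (rule z1[OF that])
  qed
  \<comment> \<open>The squared coordinates of \<open>x - y\<close> add up to \<open>q x y\<close>,
    which turns the exponent \<open>- \<beta> - 2\<close> into \<open>- \<beta> - 1\<close>; the
    coordinate-free term is counted \<open>DIM('a)\<close> times. With \<open>n\<close> the
    dimension, the coefficient is \<open>4\<beta>(\<beta> + 1) - 2\<beta>n = 2\<beta>(2\<beta> + 2 -
    n)\<close>.\<close>
  have "(\<Sum>b\<in>Basis. k2 b x y) = 2 * \<beta> * (2 * \<beta> + 2 - DIM('a)) * q x y powr (- \<beta> - 1)"
    if y: "y \<in> K" for y
  proof -
    have e: "q x y powr (- \<beta> - 1) = q x y powr (- \<beta> - 2) * q x y"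
    proof -
      have "- \<beta> - 1 = (- \<beta> - 2) + 1" by simp
      then show ?thesis using q[OF x y] by (simp only: powr_add powr_one less_imp_le)
    qed
    have qs: "q x y = (\<Sum>b\<in>Basis. ((x - y) \<bullet> b) * ((x - y) \<bullet> b))"
      unfolding q_def by (rule euclidean_inner)
    have "(\<Sum>b\<in>Basis. k2 b x y) = 4 * \<beta> * (\<beta> + 1) * q x y powr (- \<beta> - 2) *
        (\<Sum>b\<in>Basis. ((x - y) \<bullet> b) * ((x - y) \<bullet> b)) - 2 * \<beta> * DIM('a) * q x y powr (- \<beta> - 1)"
    proof -
      have "k2 b x y = 4 * \<beta> * (\<beta> + 1) * q x y powr (- \<beta> - 2) * (((x - y) \<bullet> b) * ((x - y) \<bullet> b))
          - 2 * \<beta> * q x y powr (- \<beta> - 1)" for b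
      proof -
        define d where "d = (x - y) \<bullet> b"
        show ?thesis unfolding k2_def d_def[symmetric] by (simp add: algebra_simps)
      qed
      then show ?thesis by (simp add: sum_subtractf sum_distrib_left[symmetric])
    qed
    then show ?thesis unfolding qs[symmetric] e by (simp add: algebra_simps)
  qed
  then have "pairing (\<lambda>y. 2 * \<beta> * (2 * \<beta> + 2 - DIM('a)) * q x y powr (- \<beta> - 1))
      = pairing (\<lambda>y. \<Sum>b\<in>Basis. k2 b x y)"
    by (intro pairing_cong) simp
  also have "\<dots> = (\<Sum>b\<in>Basis. pairing (k2 b x))"
    using x by (intro pairing_sum continuous_on_compose2[OF cont2, of K "\<lambda>y. (x, y)", simplified] continuous_intros) auto
  also have "\<dots> = 0" by (simp add: z2)
  finally show ?thesis using \<beta> by (simp add: pairing_cmult q_def)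
qed

text \<open>A single step asks for \<open>2\<beta> + 2 \<noteq> n\<close>; the strict inequality
  assumed here persists when \<open>\<beta>\<close> grows by 1, so the factor is non-zero at every
  stage.\<close>

lemma pairing_inverse_power_eq_0:
  fixes W :: "'a set"
  assumes W: "open W" "W \<inter> K = {}"
    and \<beta>: "\<beta> > 0" "2 * \<beta> + 2 > real DIM('a)"
    and zero: "\<And>x. x \<in> W \<Longrightarrow> pairing (\<lambda>y. ((x - y) \<bullet> (x - y)) powr (- \<beta>)) = 0"
    and x: "x \<in> W"
  shows "pairing (\<lambda>y. ((x - y) \<bullet> (x - y)) powr (- \<beta> - real m)) = 0"
  using x
proof (induction m arbitrary: x)
  case 0
  then show ?case using zero by simp
next
  case (Suc m)
  have "pairing (\<lambda>y. ((x - y) \<bullet> (x - y)) powr (- (\<beta> + real m) - 1)) = 0"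
  proof (rule pairing_inverse_power_step[OF W])
    show "pairing (\<lambda>y. ((x - y) \<bullet> (x - y)) powr - (\<beta> + real m)) = 0" if "x \<in> W" for x
      using Suc.IH[OF that] by simp
  qed (use \<beta> Suc.prems in auto)
  then show ?case by (simp add: algebra_simps)
qed

lemma pairing_gaussian_eq_0:
  fixes W :: "'a set"
  assumes W: "open W" "W \<inter> K = {}"
    and \<beta>: "\<beta> > 0" "2 * \<beta> + 2 > real DIM('a)"
    and zero: "\<And>x. x \<in> W \<Longrightarrow> pairing (\<lambda>y. ((x - y) \<bullet> (x - y)) powr (- \<beta>)) = 0"
    and x: "x \<in> W"
  shows "pairing (\<lambda>y. exp (- ((x - y) \<bullet> (x - y)))) = 0"
proof -
  define q where "q y = (x - y) \<bullet> (x - y)" for y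
  have q: "q y > 0" if "y \<in> K" for y
    using that W x unfolding q_def by auto
  have q_cont: "continuous_on K q"
    unfolding q_def by (intro continuous_intros)
  have pow_cont: "continuous_on K (\<lambda>y. q y powr r)" for r
    using q by (intro continuous_intros q_cont) force
  \<comment> \<open>Range of the variable \<open>t = |x - y|^(-2)\<close>: a compact subset of the
    open half-line, as \<open>K\<close> is compact and avoids \<open>x\<close>.\<close>
  define T where "T = (\<lambda>y. inverse (q y)) ` K"
  have T: "compact T" unfolding T_def
    using compact_K q by (intro compact_continuous_image continuous_intros q_cont) force+
  have T_pos: "t > 0" if "t \<in> T" for t using that q unfolding T_def by auto
  \<comment> \<open>Chosen so that \<open>exp (- q) = q powr (- \<beta>) * g (1 / q)\<close>.
    Approximating \<open>g\<close> rather than the Gaussian itself leaves the factor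
    \<open>q powr (- \<beta>)\<close> in place, and every term of the approximant then has an
    exponent \<open>- \<beta> - i\<close> already known to pair to 0.\<close>
  define g where "g t = t powr (- \<beta>) * exp (- inverse t)" for t :: real
  have g_cont: "continuous_on T g"
    unfolding g_def using T_pos by (intro continuous_intros) force+
  have "bounded ((\<lambda>y. q y powr (- \<beta>)) ` K)"
    using compact_K pow_cont by (intro compact_imp_bounded compact_continuous_image)
  then obtain B where B: "\<And>y. y \<in> K \<Longrightarrow> q y powr (- \<beta>) \<le> B"
    unfolding bounded_real by fastforce
  have "pairing (\<lambda>y. exp (- q y)) = 0"
  proof (rule pairing_eq_0_uniform_limit)
    show "continuous_on K (\<lambda>y. exp (- q y))" by (intro continuous_intros q_cont)
    fix e :: real assume e: "e > 0"
    \<comment> \<open>The error of the polynomial is multiplied by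
      \<open>q powr (- \<beta>)\<close>, which is at most \<open>B\<close> on
      \<open>K\<close>.\<close>
    define e' where "e' = e / (\<bar>B\<bar> + 1)"
    have "e' > 0" using e unfolding e'_def by (simp add: add_nonneg_pos)
    from Stone_Weierstrass_real_polynomial_function[OF T g_cont this] obtain p
      where p: "real_polynomial_function p" "\<And>t. t \<in> T \<Longrightarrow> \<bar>g t - p t\<bar> < e'" by blast
    obtain a n where an: "p = (\<lambda>t. \<Sum>i\<le>n. a i * t ^ i)"
      using p(1) unfolding real_polynomial_function_iff_sum by blast
    define P where "P y = q y powr (- \<beta>) * p (inverse (q y))" for y
    have P: "P y = (\<Sum>i\<le>n. a i * q y powr (- \<beta> - real i))" if "y \<in> K" for y
      unfolding P_def an sum_distrib_left
      using q[OF that] by (intro sum.cong refl)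
        (simp add: powr_diff powr_realpow power_inverse divide_inverse algebra_simps)
    have S_cont: "continuous_on K (\<lambda>y. \<Sum>i\<le>n. a i * q y powr (- \<beta> - real i))"
      by (intro continuous_on_sum continuous_on_mult continuous_on_const pow_cont)
    show "\<exists>p. continuous_on K p \<and> pairing p = 0 \<and> (\<forall>y\<in>K. \<bar>exp (- q y) - p y\<bar> \<le> e)"
    proof (intro exI[of _ P] conjI ballI)
      show "continuous_on K P"
        using S_cont P by (simp cong: continuous_on_cong)
      have "pairing P = pairing (\<lambda>y. \<Sum>i\<le>n. a i * q y powr (- \<beta> - real i))"
        by (rule pairing_cong[OF P])
      also have "\<dots> = (\<Sum>i\<le>n. pairing (\<lambda>y. a i * q y powr (- \<beta> - real i)))"
        by (intro pairing_sum continuous_on_mult continuous_on_const pow_cont)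
      also have "\<dots> = 0"
        using pairing_inverse_power_eq_0[OF W \<beta> zero x]
        by (simp add: pairing_cmult q_def)
      finally show "pairing P = 0" .
      fix y assume y: "y \<in> K"
      have "exp (- q y) = q y powr (- \<beta>) * g (inverse (q y))"
        using q[OF y] unfolding g_def by (simp add: powr_minus inverse_powr)
      then have "\<bar>exp (- q y) - P y\<bar> = q y powr (- \<beta>) * \<bar>g (inverse (q y)) - p (inverse (q y))\<bar>"
        unfolding P_def by (simp add: abs_mult right_diff_distrib[symmetric])
      also have "\<dots> \<le> \<bar>B\<bar> * e'"
        using B[OF y] p(2)[of "inverse (q y)"] y
        by (intro mult_mono) (auto simp: T_def less_imp_le)
      also have "\<dots> \<le> e" unfolding e'_def using e by (simp add: field_simps)
      finally show "\<bar>exp (- q y) - P y\<bar> \<le> e" .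
    qed
  qed
  then show ?thesis unfolding q_def .
qed

text \<open>Differentiating the Gaussian yields one linear factor, so products are built one factor
  at a time. The extra factor \<open>f\<close> makes this an induction over \<open>p\<close>: in the
  product case the second induction hypothesis is used with \<open>f * p\<close> in place of
  \<open>f\<close>. Its premise is required on all of \<open>W\<close>, hence the generalization
  over \<open>x\<close>.\<close>

lemma pairing_gaussian_polynomial_eq_0:
  fixes W :: "'a set"
  assumes W: "open W"
    and zero: "\<And>x. x \<in> W \<Longrightarrow> pairing (\<lambda>y. exp (- ((x - y) \<bullet> (x - y))) * f y) = 0"
    and f: "continuous_on K f"
    and p: "real_polynomial_function p"
    and x: "x \<in> W"
  shows "pairing (\<lambda>y. exp (- ((x - y) \<bullet> (x - y))) * (f y * p y)) = 0"
  using p zero f x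
proof (induction p arbitrary: f x rule: real_polynomial_function.induct)
  case (linear l)
  define G where "G x y = exp (- ((x - y) \<bullet> (x - y)))" for x y :: 'a
  \<comment> \<open>The vector representing the functional \<open>l\<close>; it is the direction in
    which the Gaussian is differentiated.\<close>
  define b where "b = (\<Sum>i\<in>Basis. l i *\<^sub>R i)"
  interpret l: bounded_linear l by fact
  have b: "l y = y \<bullet> b" for y
  proof -
    have "l y = l (\<Sum>i\<in>Basis. (y \<bullet> i) *\<^sub>R i)" by (simp add: euclidean_representation)
    also have "\<dots> = y \<bullet> b" by (simp add: l.sum l.scaleR b_def inner_sum_right mult.commute)
    finally show ?thesis .
  qed
  define k' where "k' x y = G x y * (- 2 * ((x - y) \<bullet> b)) * f y" for x y
  have G_cont: "continuous_on K (G x)" for x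
    unfolding G_def by (intro continuous_intros)
  have "pairing (k' x) = 0"
  proof (rule pairing_directional_derivative_eq_0[OF W linear.prems(3), where b = b and k = "\<lambda>x y. G x y * f y"])
    show "continuous_on K (\<lambda>y. G x y * f y)" for x
      by (intro continuous_intros G_cont linear.prems)
    show "continuous_on (W \<times> K) (\<lambda>z. k' (fst z) (snd z))"
      unfolding k'_def G_def
      by (intro continuous_intros continuous_on_compose2[OF linear.prems(2) continuous_on_snd]) auto
    show "((\<lambda>t. G (x + t *\<^sub>R b) y * f y) has_real_derivative k' x y) (at 0)" for x y
    proof -
      have "(x + t *\<^sub>R b - y) \<bullet> (x + t *\<^sub>R b - y)
          = (x - y) \<bullet> (x - y) + t * (2 * ((x - y) \<bullet> b)) + t * t * (b \<bullet> b)" for t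
        by (simp add: algebra_simps inner_commute)
      then have "G (x + t *\<^sub>R b) y
          = exp (- ((x - y) \<bullet> (x - y) + t * (2 * ((x - y) \<bullet> b)) + t * t * (b \<bullet> b)))" for t
        unfolding G_def by simp
      then show ?thesis unfolding k'_def
        by (auto intro!: derivative_eq_intros simp: G_def)
    qed
    show "pairing (\<lambda>y. G x y * f y) = 0" if "x \<in> W" for x
      using linear.prems(1)[OF that] unfolding G_def by simp
  qed
  \<comment> \<open>Splitting \<open>(x - y) \<bullet> b\<close> leaves the wanted factor
    \<open>l y\<close> and a multiple, constant in \<open>y\<close>, of the function that pairs to 0
    by assumption.\<close>
  moreover have "k' x = (\<lambda>y. 2 * (G x y * (f y * l y)) - 2 * (x \<bullet> b) * (G x y * f y))"
    unfolding k'_def b by (auto simp: algebra_simps)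
  moreover have "continuous_on K (\<lambda>y. l y)"
    unfolding b by (intro continuous_intros)
  moreover have "pairing (\<lambda>y. G x y * f y) = 0"
    using linear.prems unfolding G_def by simp
  ultimately have "pairing (\<lambda>y. 2 * (G x y * (f y * l y))) = 0"
    by (simp add: pairing_diff continuous_intros G_cont linear.prems pairing_cmult)
  then show ?case by (simp add: pairing_cmult G_def)
next
  case (const c)
  have "pairing (\<lambda>y. c * (exp (- ((x - y) \<bullet> (x - y))) * f y)) = 0"
    using const.prems by (simp add: pairing_cmult)
  then show ?case by (simp only: mult_ac)
next
  case (add p q)
  have "continuous_on K p" "continuous_on K q"
    using add.hyps continuous_on_polymonial_function real_polynomial_function_eq by blast+
  then have "pairing (\<lambda>y. exp (- ((x - y) \<bullet> (x - y))) * (f y * p y) + exp (- ((x - y) \<bullet> (x - y))) * (f y * q y)) = 0"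
    using add.IH[OF add.prems(1,2,3)] add.prems(2)
    by (subst pairing_add) (auto intro!: continuous_intros)
  then show ?case by (simp add: distrib_left)
next
  case (mult p q)
  have cp: "continuous_on K p"
    using mult.hyps continuous_on_polymonial_function real_polynomial_function_eq by blast
  have "pairing (\<lambda>y. exp (- ((x - y) \<bullet> (x - y))) * (f y * p y * q y)) = 0"
  proof (rule mult.IH(2))
    show "pairing (\<lambda>y. exp (- ((x - y) \<bullet> (x - y))) * (f y * p y)) = 0" if "x \<in> W" for x
      using mult.IH(1)[OF mult.prems(1,2) that] by blast
    show "continuous_on K (\<lambda>y. f y * p y)" by (intro continuous_intros cp mult.prems)
  qed fact
  then show ?case by (simp add: mult.assoc)
qed

text \<open>The quotient of \<open>f\<close> by the Gaussian is approximated on \<open>K\<close> by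
  a polynomial. Multiplying back does not enlarge the error, since the Gaussian is at most
  1.\<close>

lemma pairing_continuous_eq_0:
  fixes W :: "'a set"
  assumes W: "open W" "x \<in> W"
    and zero: "\<And>x. x \<in> W \<Longrightarrow> pairing (\<lambda>y. exp (- ((x - y) \<bullet> (x - y)))) = 0"
    and f: "continuous_on K f"
  shows "pairing f = 0"
proof (rule pairing_eq_0_uniform_limit[OF f])
  fix e :: real assume e: "e > 0"
  define G where "G y = exp (- ((x - y) \<bullet> (x - y)))" for y
  have G: "continuous_on K G" "G y > 0" "G y \<le> 1" for y
    unfolding G_def by (auto intro!: continuous_intros)
  have "continuous_on K (\<lambda>y. f y / G y)"
    using G(2) by (intro continuous_intros f G(1)) (auto simp: less_imp_neq[symmetric])
  from Stone_Weierstrass_real_polynomial_function[OF compact_K this e] obtain p where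
    p: "real_polynomial_function p" "\<And>y. y \<in> K \<Longrightarrow> \<bar>f y / G y - p y\<bar> < e" by blast
  show "\<exists>p. continuous_on K p \<and> pairing p = 0 \<and> (\<forall>y\<in>K. \<bar>f y - p y\<bar> \<le> e)"
  proof (intro exI[of _ "\<lambda>y. G y * p y"] conjI ballI)
    show "continuous_on K (\<lambda>y. G y * p y)"
      using p(1) by (intro continuous_intros G continuous_on_polymonial_function)
        (simp add: real_polynomial_function_eq)
    show "pairing (\<lambda>y. G y * p y) = 0"
      using pairing_gaussian_polynomial_eq_0[OF W(1) _ _ p(1) W(2), of "\<lambda>_. 1"] zero
      by (simp add: G_def)
    fix y assume y: "y \<in> K"
    have "\<bar>f y - G y * p y\<bar> = G y * \<bar>f y / G y - p y\<bar>"
      using G(2)[of y] by (simp add: abs_mult_pos' right_diff_distrib)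
    also have "\<dots> \<le> 1 * e" using G(2,3)[of y] p(2)[OF y] by (intro mult_mono) auto
    finally show "\<bar>f y - G y * p y\<bar> \<le> e" by simp
  qed
qed

text \<open>Testing with the sign of \<open>w\<close> would give the integral of \<open>|w|\<close>.
  The sign is measurable, hence an almost everywhere limit of continuous functions, and dominated
  convergence transfers the vanishing to it.\<close>

lemma density_AE_eq_0:
  assumes zero: "\<And>f. continuous_on UNIV f \<Longrightarrow> pairing f = 0"
  shows "AE y in lborel. w y = 0"
proof -
  have "(\<lambda>y. sgn (w y)) \<in> borel_measurable borel"
    using borel_measurable_integrable[OF integrable_w] by simp
  then have "(\<lambda>y. sgn (w y)) \<in> borel_measurable (lebesgue_on UNIV)"
    by (simp add: measurable_completion lebesgue_on_UNIV_eq)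
  then have "(\<lambda>y. sgn (w y)) measurable_on UNIV"
    by (intro lebesgue_measurable_imp_measurable_on) auto
  then obtain N g where N: "negligible N" and g: "\<And>n. continuous_on UNIV (g n)"
    "\<And>y. y \<notin> N \<Longrightarrow> (\<lambda>n. g n y) \<longlonglongrightarrow> sgn (w y)"
    unfolding measurable_on_def by auto
  \<comment> \<open>Clipping keeps continuity and the limit, whose values lie in
    \<open>[-1, 1]\<close>, and makes \<open>|w|\<close> a dominating function.\<close>
  define h where "h n y = max (- 1) (min 1 (g n y))" for n :: nat and y
  have h: "continuous_on UNIV (h n)" for n
    unfolding h_def by (intro continuous_intros g)
  have h_lim: "(\<lambda>n. h n y) \<longlonglongrightarrow> sgn (w y)" if "y \<notin> N" for y
  proof -
    have "(\<lambda>n. h n y) \<longlonglongrightarrow> max (- 1) (min 1 (sgn (w y)))"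
      unfolding h_def by (intro tendsto_intros g that)
    then show ?thesis by (auto simp: sgn_if split: if_splits)
  qed
  have "(\<lambda>n. pairing (h n)) \<longlonglongrightarrow> (\<integral>y. w y * sgn (w y) \<partial>lborel)"
    unfolding pairing_def
  proof (rule integral_dominated_convergence[where w = "\<lambda>y. \<bar>w y\<bar>"])
    show "integrable lborel (\<lambda>y. \<bar>w y\<bar>)" using integrable_w by simp
    show "(\<lambda>y. w y * sgn (w y)) \<in> borel_measurable lborel"
      using borel_measurable_integrable[OF integrable_w] by simp
    show "(\<lambda>y. w y * h n y) \<in> borel_measurable lborel" for n
      using measurable_pairing[OF continuous_on_subset[OF h]] by simp
    have "N \<in> null_sets lebesgue" using N by (simp add: negligible_iff_null_sets)
    then have "AE y in lborel. y \<notin> N"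
      using AE_not_in AE_completion_iff by blast
    then show "AE y in lborel. (\<lambda>n. w y * h n y) \<longlonglongrightarrow> w y * sgn (w y)"
      by eventually_elim (intro tendsto_intros h_lim)
    show "AE y in lborel. norm (w y * h n y) \<le> \<bar>w y\<bar>" for n
      by (intro AE_I2) (auto simp: h_def abs_mult intro!: mult_left_le)
  qed
  then have "(\<integral>y. w y * sgn (w y) \<partial>lborel) = 0"
    using h zero by (simp add: LIMSEQ_const_iff)
  then have "(\<integral>y. \<bar>w y\<bar> \<partial>lborel) = 0"
    by (simp add: abs_sgn)
  then show ?thesis
    using integrable_w integral_nonneg_eq_0_iff_AE[of lborel "\<lambda>y. \<bar>w y\<bar>"] by simp
qed

end

section \<open>Test functions and fractional Sobolev spaces\<close>

text \<open>The standard majorant for the singular kernel. Near the origin it is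
  \<open>|h|^(2-n-2s)\<close>, integrable because \<open>s < 1\<close>; far away it is
  \<open>|h|^(-n-2s)\<close>, integrable because \<open>s > 0\<close>.\<close>

lemma min_one_sq_powr_integrable:
  assumes s: "0 < s" "s < 1"
  shows "integrable lborel
    (\<lambda>h::'a::euclidean_space. min 1 ((norm h)\<^sup>2) / norm h powr (real DIM('a) + 2 * s))"
    (is "integrable lborel ?g")
proof (rule integrableI_bounded)
  show "?g \<in> borel_measurable lborel" by measurable
  define n where "n = real DIM('a)"
  define \<alpha> where "\<alpha> = n + 2 * s"
  define c where "c = unit_ball_vol n"
  have n: "n \<ge> 1" unfolding n_def using DIM_positive[where 'a='a] by linarith
  have c: "c \<ge> 0" unfolding c_def using n by simp
  \<comment> \<open>\<open>A k\<close> bounds the function on the shell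
    \<open>2^(-k-1) < |h| \<le> 2^(-k)\<close>, and \<open>B k\<close> on
    \<open>2^k \<le> |h| < 2^(k+1)\<close>. The balls \<open>S k\<close> and \<open>T k\<close>
    contain these shells and have explicit volumes; the enlargement costs only a constant.\<close>
  define A where "A k = 2 powr (- 2 * real k + (real k + 1) * \<alpha>)" for k :: nat
  define B where "B k = 2 powr (- real k * \<alpha>)" for k :: nat
  define S where "S k = cball (0::'a) (2 powr (- real k))" for k :: nat
  define T where "T k = cball (0::'a) (2 powr (real k + 1))" for k :: nat
  have \<alpha>: "\<alpha> > 0" unfolding \<alpha>_def using n s by simp
  have [measurable]: "S k \<in> sets borel" "T k \<in> sets borel" for k
    unfolding S_def T_def by simp_all
  \<comment> \<open>dyadic shells around the origin and around infinity\<close>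
  have pw: "?g h \<le> (\<Sum>k. ennreal (A k) * indicator (S k) h + ennreal (B k) * indicator (T k) h)" for h
  proof (cases "h = 0")
    case False
    define l where "l = - log 2 (norm h)"
    have l: "norm h = 2 powr (- l)" using False unfolding l_def by simp
    define k where "k = nat \<lfloor>\<bar>l\<bar>\<rfloor>"
    have k: "real k \<le> \<bar>l\<bar>" "\<bar>l\<bar> < real k + 1" unfolding k_def by linarith+
    have "ennreal (?g h) \<le> ennreal (A k) * indicator (S k) h + ennreal (B k) * indicator (T k) h"
    proof (cases "l \<ge> 0")
      case True
      have "?g h \<le> (norm h)\<^sup>2 / norm h powr \<alpha>"
        unfolding \<alpha>_def n_def by (intro divide_right_mono) auto
      also have "\<dots> = 2 powr (- 2 * l + l * \<alpha>)"
      proof -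
        have "(norm h)\<^sup>2 = 2 powr (- 2 * l)"
          unfolding l by (simp add: power2_eq_square powr_add[symmetric])
        moreover have "norm h powr \<alpha> = 2 powr (- (l * \<alpha>))"
          unfolding l by (simp add: powr_powr)
        ultimately show ?thesis by (simp add: powr_diff[symmetric])
      qed
      also have "\<dots> \<le> A k"
        unfolding A_def using True k \<alpha> by (intro powr_mono add_mono mult_right_mono) auto
      finally have "ennreal (?g h) \<le> ennreal (A k)" by (rule ennreal_leI)
      moreover have "h \<in> S k" unfolding S_def using True k l by simp
      ultimately show ?thesis by (simp add: add_increasing2)
    next
      case False
      have "?g h \<le> 1 / norm h powr \<alpha>"
        unfolding \<alpha>_def n_def by (intro divide_right_mono) auto
      also have "\<dots> = 2 powr (l * \<alpha>)"
      proof -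
        have "norm h powr \<alpha> = 2 powr (- (l * \<alpha>))"
          unfolding l by (simp add: powr_powr)
        then show ?thesis by (simp add: powr_minus divide_inverse)
      qed
      also have "\<dots> \<le> B k"
        unfolding B_def using False k \<alpha> by (intro powr_mono mult_right_mono) auto
      finally have "ennreal (?g h) \<le> ennreal (B k)" by (rule ennreal_leI)
      moreover have "h \<in> T k" unfolding T_def using False k l by simp
      ultimately show ?thesis by (simp add: add_increasing)
    qed
    also have "\<dots> \<le> (\<Sum>k. ennreal (A k) * indicator (S k) h + ennreal (B k) * indicator (T k) h)"
      using sum_le_suminf[of "\<lambda>k. ennreal (A k) * indicator (S k) h + ennreal (B k) * indicator (T k) h" "{k}"]
      by simp
    finally show ?thesis .
  qed simp
  \<comment> \<open>Bound times volume is geometric in \<open>k\<close>: ratio \<open>r1\<close> for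
    the inner shells, \<open>r2\<close> for the outer ones. The two bounds on \<open>s\<close> make
    these ratios less than 1.\<close>
  define r1 where "r1 = 2 powr (2 * s - 2)"
  define r2 where "r2 = 2 powr (- 2 * s)"
  have r: "0 \<le> r1" "r1 < 1" "0 \<le> r2" "r2 < 1"
    unfolding r1_def r2_def using s by (auto intro: powr_less_one)
  have "(\<integral>\<^sup>+h. ennreal (norm (?g h)) \<partial>lborel) \<le>
      (\<integral>\<^sup>+h. (\<Sum>k. ennreal (A k) * indicator (S k) h + ennreal (B k) * indicator (T k) h) \<partial>lborel)"
    using pw by (intro nn_integral_mono) simp
  also have "\<dots> = (\<Sum>k. \<integral>\<^sup>+h. (ennreal (A k) * indicator (S k) h + ennreal (B k) * indicator (T k) h) \<partial>lborel)"
    by (intro nn_integral_suminf) measurable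
  also have "\<dots> = (\<Sum>k. ennreal (c * 2 powr \<alpha> * r1 ^ k + c * 2 powr n * r2 ^ k))"
  proof (intro suminf_cong)
    fix k
    have pw': "r1 ^ k = 2 powr (real k * (2 * s - 2))" "r2 ^ k = 2 powr (real k * (- 2 * s))"
      unfolding r1_def r2_def by (simp_all add: powr_powr mult.commute flip: powr_realpow)
    have S: "emeasure lborel (S k) = ennreal (c * 2 powr (- real k * n))"
      unfolding S_def c_def n_def by (simp add: emeasure_cball powr_powr flip: powr_realpow)
    have T: "emeasure lborel (T k) = ennreal (c * 2 powr ((real k + 1) * n))"
      unfolding T_def c_def n_def by (simp add: emeasure_cball powr_powr flip: powr_realpow)
    have "(\<integral>\<^sup>+h. (ennreal (A k) * indicator (S k) h + ennreal (B k) * indicator (T k) h) \<partial>lborel)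
      = ennreal (A k) * emeasure lborel (S k) + ennreal (B k) * emeasure lborel (T k)"
      by (simp add: nn_integral_add nn_integral_cmult_indicator)
    also have "\<dots> = ennreal (A k * (c * 2 powr (- real k * n)) + B k * (c * 2 powr ((real k + 1) * n)))"
      unfolding S T using c by (simp add: A_def B_def ennreal_mult' ennreal_plus)
    also have "A k * (c * 2 powr (- real k * n)) = c * 2 powr \<alpha> * r1 ^ k"
    proof -
      have "A k * 2 powr (- real k * n) = 2 powr \<alpha> * r1 ^ k"
        unfolding A_def pw' powr_add[symmetric] \<alpha>_def by (simp add: algebra_simps)
      then show ?thesis by simp
    qed
    also have "B k * (c * 2 powr ((real k + 1) * n)) = c * 2 powr n * r2 ^ k"
    proof -
      have "B k * 2 powr ((real k + 1) * n) = 2 powr n * r2 ^ k"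
        unfolding B_def pw' powr_add[symmetric] \<alpha>_def by (simp add: algebra_simps)
      then show ?thesis by simp
    qed
    finally show "(\<integral>\<^sup>+h. (ennreal (A k) * indicator (S k) h + ennreal (B k) * indicator (T k) h) \<partial>lborel)
      = ennreal (c * 2 powr \<alpha> * r1 ^ k + c * 2 powr n * r2 ^ k)" .
  qed
  also have "\<dots> < \<infinity>"
  proof -
    have "summable (\<lambda>k. c * 2 powr \<alpha> * r1 ^ k + c * 2 powr n * r2 ^ k)"
      using r by (intro summable_add summable_mult summable_geometric) auto
    then show ?thesis using c r by (subst suminf_ennreal2) auto
  qed
  finally show "(\<integral>\<^sup>+h. ennreal (norm (?g h)) \<partial>lborel) < \<infinity>" .
qed

lemma min_one_dist_sq_powr_integrable:
  assumes "0 < s" "s < 1"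
  shows "integrable lborel
    (\<lambda>y::'a::euclidean_space. min 1 ((dist x y)\<^sup>2) / dist x y powr (real DIM('a) + 2 * s))"
proof -
  have "integrable (distr lborel borel ((+) (- x)))
    (\<lambda>h::'a. min 1 ((norm h)\<^sup>2) / norm h powr (real DIM('a) + 2 * s))"
    unfolding lborel_distr_plus by (rule min_one_sq_powr_integrable[OF assms])
  then show ?thesis
    by (subst (asm) integrable_distr_eq) (auto simp: dist_norm norm_minus_commute)
qed

section \<open>Regularity of smooth functions with compact support\<close>

lemma smooth_fun_differentiable: "smooth_fun f \<Longrightarrow> f differentiable (at x)"
  unfolding smooth_fun_def by blast

lemma smooth_fun_partial_continuous:
  assumes "smooth_fun f" "b \<in> Basis"
  shows "continuous_on UNIV (\<lambda>x. frechet_derivative f (at x) b)"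
proof -
  have "\<forall>x. (\<lambda>x. frechet_derivative f (at x) b) differentiable (at x)"
    using assms unfolding smooth_fun_def by blast
  then show ?thesis
    by (intro continuous_at_imp_continuous_on ballI differentiable_imp_continuous_within) auto
qed

lemma smooth_fun_continuous: "smooth_fun f \<Longrightarrow> continuous_on UNIV f"
  by (intro continuous_at_imp_continuous_on ballI differentiable_imp_continuous_within
      smooth_fun_differentiable)

text \<open>A class witnessing smoothness of the difference consists of all differences of members
  of the two given classes; partial derivatives respect it.\<close>

lemma smooth_fun_diff:
  assumes "smooth_fun f" "smooth_fun g"
  shows "smooth_fun (\<lambda>x. f x - g x)"
proof -
  obtain S T where S: "f \<in> S" "\<And>h x. h \<in> S \<Longrightarrow> h differentiable (at x)"
      "\<And>h b. h \<in> S \<Longrightarrow> b \<in> Basis \<Longrightarrow> (\<lambda>x. frechet_derivative h (at x) b) \<in> S"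
    and T: "g \<in> T" "\<And>h x. h \<in> T \<Longrightarrow> h differentiable (at x)"
      "\<And>h b. h \<in> T \<Longrightarrow> b \<in> Basis \<Longrightarrow> (\<lambda>x. frechet_derivative h (at x) b) \<in> T"
    using assms unfolding smooth_fun_def by metis
  define U where "U = {\<lambda>x. h x - k x | h k. h \<in> S \<and> k \<in> T}"
  have "frechet_derivative (\<lambda>x. h x - k x) (at x) b
      = frechet_derivative h (at x) b - frechet_derivative k (at x) b"
    if "h \<in> S" "k \<in> T" for h k x b
  proof -
    have "((\<lambda>x. h x - k x) has_derivative
        (\<lambda>v. frechet_derivative h (at x) v - frechet_derivative k (at x) v)) (at x)"
      using S(2)[OF that(1)] T(2)[OF that(2)]
      by (intro has_derivative_diff) (simp_all add: frechet_derivative_works)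
    from frechet_derivative_at[OF this] show ?thesis by metis
  qed
  then have "(\<lambda>x. frechet_derivative h (at x) b) \<in> U" if "h \<in> U" "b \<in> Basis" for h b
    using that S(3) T(3) unfolding U_def by fastforce
  moreover have "h differentiable (at x)" if "h \<in> U" for h x
    using that S(2) T(2) unfolding U_def by (auto intro: differentiable_diff)
  moreover have "(\<lambda>x. f x - g x) \<in> U"
    using S(1) T(1) unfolding U_def by blast
  ultimately show ?thesis unfolding smooth_fun_def by blast
qed

lemma test_fun_diff:
  assumes "test_fun U \<phi>" "test_fun U \<psi>"
  shows "test_fun U (\<lambda>x. \<phi> x - \<psi> x)"
proof -
  obtain K L where "compact K" "K \<subseteq> U" "\<And>x. x \<notin> K \<Longrightarrow> \<phi> x = 0"
    "compact L" "L \<subseteq> U" "\<And>x. x \<notin> L \<Longrightarrow> \<psi> x = 0"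
    using assms unfolding test_fun_def by blast
  then have "compact (K \<union> L)" "K \<union> L \<subseteq> U" "\<forall>x. x \<notin> K \<union> L \<longrightarrow> \<phi> x - \<psi> x = 0"
    by (auto intro: compact_Un)
  then show ?thesis
    using assms smooth_fun_diff unfolding test_fun_def by blast
qed

lemma continuous_compact_support_bounded:
  fixes f :: "'a::euclidean_space \<Rightarrow> real"
  assumes "continuous_on UNIV f" "compact K" "\<And>x. x \<notin> K \<Longrightarrow> f x = 0"
  obtains B where "B > 0" "\<And>x. \<bar>f x\<bar> \<le> B"
proof -
  have "bounded (f ` K)"
    using assms by (intro compact_imp_bounded compact_continuous_image continuous_on_subset[OF assms(1)]) auto
  then obtain B where "B > 0" "\<And>y. y \<in> f ` K \<Longrightarrow> \<bar>y\<bar> \<le> B"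
    unfolding bounded_pos by auto
  then show thesis
    using assms(3) by (intro that[of B]) (auto, metis abs_zero less_imp_le imageI)
qed

text \<open>Each partial derivative is continuous and vanishes off \<open>K\<close>, hence is
  bounded. The sum of these bounds controls the operator norm of the derivative, and the mean value
  inequality on the convex set \<open>UNIV\<close> finishes.\<close>

lemma smooth_compact_support_lipschitz:
  fixes \<phi> :: "'a::euclidean_space \<Rightarrow> real"
  assumes \<phi>: "smooth_fun \<phi>" and K: "compact K" "\<And>x. x \<notin> K \<Longrightarrow> \<phi> x = 0"
  obtains B where "B > 0" "\<And>x y. \<bar>\<phi> x - \<phi> y\<bar> \<le> B * norm (x - y)"
proof -
  have zero: "frechet_derivative \<phi> (at x) b = 0" if "x \<notin> K" for x b
  proof -
    have "(\<phi> has_derivative (\<lambda>_. 0)) (at x)"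
    proof (rule has_derivative_transform_within_open)
      show "((\<lambda>_. 0) has_derivative (\<lambda>_. 0)) (at x)" by simp
      show "open (- K)" using K by (simp add: compact_imp_closed open_Compl)
    qed (use that K in auto)
    from frechet_derivative_at[OF this] show ?thesis by metis
  qed
  have "\<exists>B>0. \<forall>x. \<bar>frechet_derivative \<phi> (at x) b\<bar> \<le> B" if "b \<in> Basis" for b
    using continuous_compact_support_bounded[OF smooth_fun_partial_continuous[OF \<phi> that] K(1) zero]
    by metis
  then obtain M where M: "\<And>b. b \<in> Basis \<Longrightarrow> M b > 0"
      "\<And>b x. b \<in> Basis \<Longrightarrow> \<bar>frechet_derivative \<phi> (at x) b\<bar> \<le> M b"
    by metis
  define B where "B = (\<Sum>b\<in>Basis. M b)"
  have "B > 0" unfolding B_def using M(1) by (intro sum_pos) auto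
  have der: "(\<phi> has_derivative frechet_derivative \<phi> (at x)) (at x)" for x
    using smooth_fun_differentiable[OF \<phi>] by (simp add: frechet_derivative_works)
  have "onorm (frechet_derivative \<phi> (at x)) \<le> B" for x
  proof (rule onorm_le)
    fix v
    interpret l: bounded_linear "frechet_derivative \<phi> (at x)"
      using der by (rule has_derivative_bounded_linear)
    have "frechet_derivative \<phi> (at x) v = (\<Sum>b\<in>Basis. (v \<bullet> b) * frechet_derivative \<phi> (at x) b)"
      by (subst (1) euclidean_representation[symmetric, of v]) (simp add: l.sum l.scaleR)
    also have "\<bar>\<dots>\<bar> \<le> (\<Sum>b\<in>Basis. norm v * M b)"
      by (intro order.trans[OF sum_abs] sum_mono)
        (auto simp: abs_mult intro!: mult_mono M(2) Basis_le_norm)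
    finally show "norm (frechet_derivative \<phi> (at x) v) \<le> B * norm v"
      unfolding B_def by (simp add: sum_distrib_left mult.commute)
  qed
  then have "norm (\<phi> x - \<phi> y) \<le> B * norm (x - y)" for x y
    using der by (intro differentiable_bound[of UNIV]) (auto intro: has_derivative_at_withinI)
  then show thesis using \<open>B > 0\<close> by (intro that[of B]) auto
qed

text \<open>The Gagliardo integrand vanishes unless one of the two points lies in \<open>K\<close>.
  There it is at most a multiple of the integrable kernel of \<open>x - y\<close>, by the Lipschitz
  bound at short range and boundedness at long range.\<close>

lemma test_fun_Hs:
  fixes \<phi> :: "'a::euclidean_space \<Rightarrow> real"
  assumes s: "0 < s" "s < 1" and \<phi>: "test_fun U \<phi>"
  shows "\<phi> \<in> Hs s"
proof -
  obtain K where sm: "smooth_fun \<phi>" and K: "compact K" "\<And>x. x \<notin> K \<Longrightarrow> \<phi> x = 0"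
    using \<phi> unfolding test_fun_def by blast
  have [measurable]: "\<phi> \<in> borel_measurable borel"
    using smooth_fun_continuous[OF sm] by (rule borel_measurable_continuous_onI)
  have Km[measurable]: "K \<in> sets borel" using K by (intro borel_closed compact_imp_closed)
  have K_fin: "emeasure lborel K < \<infinity>"
    using compact_imp_bounded[OF K(1)] by (rule emeasure_bounded_finite)
  obtain M where M: "M > 0" "\<And>x. \<bar>\<phi> x\<bar> \<le> M"
    using continuous_compact_support_bounded[OF smooth_fun_continuous[OF sm] K] by metis
  obtain L where L: "L > 0" "\<And>x y. \<bar>\<phi> x - \<phi> y\<bar> \<le> L * norm (x - y)"
    using smooth_compact_support_lipschitz[OF sm K] by metis
  have L2: "integrable lborel (\<lambda>x. (\<phi> x)\<^sup>2)"
  proof (rule Bochner_Integration.integrable_bound)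
    show "integrable lborel (\<lambda>x. M\<^sup>2 * indicator K x)"
      using K_fin by (intro integrable_mult_right integrable_real_indicator) auto
    show "AE x in lborel. norm ((\<phi> x)\<^sup>2) \<le> norm (M\<^sup>2 * indicator K x :: real)"
      using M K(2) by (intro AE_I2) (auto simp: indicator_def abs_le_square_iff[symmetric] simp del: power_abs)
  qed measurable
  define \<alpha> where "\<alpha> = real DIM('a) + 2 * s"
  define g where "g h = min 1 ((norm h)\<^sup>2) / norm h powr \<alpha>" for h :: 'a
  have g_int: "integrable lborel g"
    unfolding g_def \<alpha>_def by (rule min_one_sq_powr_integrable[OF s])
  have [measurable]: "g \<in> borel_measurable borel" using borel_measurable_integrable[OF g_int] by simp
  \<comment> \<open>\<open>L^2\<close> comes from the Lipschitz bound and \<open>4 M^2\<close> from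
    \<open>|\<phi> x - \<phi> y| \<le> 2 M\<close>; the sum serves both cases of the minimum in
    \<open>g\<close>.\<close>
  define C where "C = L\<^sup>2 + 4 * M\<^sup>2"
  have C: "C \<ge> 0" unfolding C_def by simp
  have bound: "(\<phi> x - \<phi> y)\<^sup>2 / dist x y powr \<alpha> \<le> C * g (x - y) * indicator K x + C * g (x - y) * indicator K y"
    for x y
  proof (cases "x \<in> K \<or> y \<in> K")
    case True
    have a: "(\<phi> x - \<phi> y)\<^sup>2 \<le> (L * norm (x - y))\<^sup>2"
      using L(2)[of x y] L(1) by (intro abs_le_square_iff[THEN iffD1]) simp
    have "\<bar>\<phi> x - \<phi> y\<bar> \<le> 2 * M" using M(2)[of x] M(2)[of y] by linarith
    then have b: "(\<phi> x - \<phi> y)\<^sup>2 \<le> (2 * M)\<^sup>2"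
      using M(1) by (intro abs_le_square_iff[THEN iffD1]) simp
    have "(\<phi> x - \<phi> y)\<^sup>2 \<le> C * min 1 ((norm (x - y))\<^sup>2)"
    proof (cases "(norm (x - y))\<^sup>2 \<le> 1")
      case True
      then show ?thesis using a unfolding C_def
        by (simp add: min_def power_mult_distrib algebra_simps add_increasing2)
    next
      case False
      then show ?thesis using b unfolding C_def
        by (simp add: min_def power_mult_distrib add_increasing)
    qed
    then have "(\<phi> x - \<phi> y)\<^sup>2 / dist x y powr \<alpha> \<le> C * g (x - y)"
      unfolding g_def dist_norm by (simp add: divide_right_mono)
    moreover have "0 \<le> C * g (x - y)" using C unfolding g_def by simp
    ultimately show ?thesis using True by (auto simp: indicator_def)
  next
    case False
    then show ?thesis using K(2) by simp
  qed
  define I where "I = (\<integral>\<^sup>+h. ennreal (C * g h) \<partial>lborel)"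
  have I: "I < \<infinity>"
  proof -
    have "integrable lborel (\<lambda>h. C * g h)" using g_int by simp
    from integrableD(2)[OF this] show ?thesis unfolding I_def
      by (simp add: integrable_iff_bounded less_top)
  qed
  have I2: "(\<integral>\<^sup>+x. ennreal (C * g (x - y)) \<partial>lborel) = I" for y
  proof -
    have "I = (\<integral>\<^sup>+h. ennreal (C * g h) \<partial>distr lborel borel ((+) (- y)))"
      unfolding I_def by (simp only: lborel_distr_plus)
    then show ?thesis by (simp add: nn_integral_distr)
  qed
  have I1: "(\<integral>\<^sup>+y. ennreal (C * g (x - y)) \<partial>lborel) = I" for x
    using I2[of x] unfolding g_def by (simp add: norm_minus_commute)
  have "integrable (lborel \<Otimes>\<^sub>M lborel) (\<lambda>z. (\<phi> (fst z) - \<phi> (snd z))\<^sup>2 / dist (fst z) (snd z) powr \<alpha>)"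
  proof (rule integrableI_bounded)
    have "(\<integral>\<^sup>+z. ennreal (norm ((\<phi> (fst z) - \<phi> (snd z))\<^sup>2 / dist (fst z) (snd z) powr \<alpha>)) \<partial>(lborel \<Otimes>\<^sub>M lborel))
      \<le> (\<integral>\<^sup>+z. (ennreal (C * g (fst z - snd z)) * indicator K (fst z)
          + ennreal (C * g (fst z - snd z)) * indicator K (snd z)) \<partial>(lborel \<Otimes>\<^sub>M lborel))"
    proof (intro nn_integral_mono)
      fix z :: "'a \<times> 'a"
      have g0: "0 \<le> C * g (fst z - snd z)" using C unfolding g_def by simp
      have "ennreal (norm ((\<phi> (fst z) - \<phi> (snd z))\<^sup>2 / dist (fst z) (snd z) powr \<alpha>))
        \<le> ennreal (C * g (fst z - snd z) * indicator K (fst z) + C * g (fst z - snd z) * indicator K (snd z))"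
        using bound[of "fst z" "snd z"] by (intro ennreal_leI) simp
      also have "\<dots> = ennreal (C * g (fst z - snd z)) * indicator K (fst z)
          + ennreal (C * g (fst z - snd z)) * indicator K (snd z)"
        using g0 by (auto simp: indicator_def)
      finally show "ennreal (norm ((\<phi> (fst z) - \<phi> (snd z))\<^sup>2 / dist (fst z) (snd z) powr \<alpha>))
        \<le> ennreal (C * g (fst z - snd z)) * indicator K (fst z)
          + ennreal (C * g (fst z - snd z)) * indicator K (snd z)" .
    qed
    also have "\<dots> = (\<integral>\<^sup>+z. ennreal (C * g (fst z - snd z)) * indicator K (fst z) \<partial>(lborel \<Otimes>\<^sub>M lborel))
      + (\<integral>\<^sup>+z. ennreal (C * g (fst z - snd z)) * indicator K (snd z) \<partial>(lborel \<Otimes>\<^sub>M lborel))"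
      by (intro nn_integral_add) measurable
    \<comment> \<open>Tonelli: integrating out the point not confined to \<open>K\<close> gives the
      constant \<open>I\<close>, by translation invariance and evenness of \<open>g\<close>; what
      remains is \<open>I\<close> times the measure of \<open>K\<close>.\<close>
    also have "(\<integral>\<^sup>+z. ennreal (C * g (fst z - snd z)) * indicator K (fst z) \<partial>(lborel \<Otimes>\<^sub>M lborel))
      = (\<integral>\<^sup>+x. (\<integral>\<^sup>+y. ennreal (C * g (x - y)) * indicator K x \<partial>lborel) \<partial>lborel)"
      by (subst lborel.nn_integral_fst[symmetric]) simp_all
    also have "\<dots> = (\<integral>\<^sup>+x. I * indicator K x \<partial>lborel)"
      by (simp add: nn_integral_multc I1)
    also have "(\<integral>\<^sup>+z. ennreal (C * g (fst z - snd z)) * indicator K (snd z) \<partial>(lborel \<Otimes>\<^sub>M lborel))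
      = (\<integral>\<^sup>+y. (\<integral>\<^sup>+x. ennreal (C * g (x - y)) * indicator K y \<partial>lborel) \<partial>lborel)"
      by (subst lborel_pair.nn_integral_snd[symmetric]) simp_all
    also have "\<dots> = (\<integral>\<^sup>+y. I * indicator K y \<partial>lborel)"
      by (simp add: nn_integral_multc I2)
    also have "(\<integral>\<^sup>+x. I * indicator K x \<partial>lborel) + (\<integral>\<^sup>+y. I * indicator K y \<partial>lborel) < \<infinity>"
      using I K_fin by (simp add: nn_integral_cmult_indicator ennreal_mult_less_top)
    finally show "(\<integral>\<^sup>+z. ennreal (norm ((\<phi> (fst z) - \<phi> (snd z))\<^sup>2 / dist (fst z) (snd z) powr \<alpha>)) 
      \<partial>(lborel \<Otimes>\<^sub>M lborel)) < \<infinity>" .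
  qed measurable
  with L2 show ?thesis unfolding Hs_def \<alpha>_def by simp
qed

lemma Hs_diff:
  fixes u v :: "'a::euclidean_space \<Rightarrow> real"
  assumes "u \<in> Hs s" "v \<in> Hs s"
  shows "(\<lambda>x. u x - v x) \<in> Hs s"
proof -
  have [measurable]: "u \<in> borel_measurable borel" "v \<in> borel_measurable borel"
    using assms unfolding Hs_def by auto
  have sq: "(a - b)\<^sup>2 \<le> 2 * a\<^sup>2 + 2 * b\<^sup>2" for a b :: real
    using zero_le_power2[of "a + b"] by (simp add: power2_eq_square algebra_simps)
  have "integrable lborel (\<lambda>x. (u x - v x)\<^sup>2)"
  proof (rule Bochner_Integration.integrable_bound)
    show "integrable lborel (\<lambda>x. 2 * (u x)\<^sup>2 + 2 * (v x)\<^sup>2)"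
      using assms unfolding Hs_def by auto
  qed (use sq in auto)
  moreover have "integrable (lborel \<Otimes>\<^sub>M lborel)
      (\<lambda>z. ((u (fst z) - v (fst z)) - (u (snd z) - v (snd z)))\<^sup>2
        / dist (fst z) (snd z) powr (real DIM('a) + 2 * s))"
  proof (rule Bochner_Integration.integrable_bound)
    show "integrable (lborel \<Otimes>\<^sub>M lborel)
      (\<lambda>z. 2 * ((u (fst z) - u (snd z))\<^sup>2 / dist (fst z) (snd z) powr (real DIM('a) + 2 * s))
        + 2 * ((v (fst z) - v (snd z))\<^sup>2 / dist (fst z) (snd z) powr (real DIM('a) + 2 * s)))"
      using assms unfolding Hs_def by (intro Bochner_Integration.integrable_add integrable_mult_right) auto
    show "AE z in lborel \<Otimes>\<^sub>M lborel.
      norm (((u (fst z) - v (fst z)) - (u (snd z) - v (snd z)))\<^sup>2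
        / dist (fst z) (snd z) powr (real DIM('a) + 2 * s))
      \<le> norm (2 * ((u (fst z) - u (snd z))\<^sup>2 / dist (fst z) (snd z) powr (real DIM('a) + 2 * s))
        + 2 * ((v (fst z) - v (snd z))\<^sup>2 / dist (fst z) (snd z) powr (real DIM('a) + 2 * s)))"
    proof (intro AE_I2)
      fix z :: "'a \<times> 'a"
      have "((u (fst z) - v (fst z)) - (u (snd z) - v (snd z)))\<^sup>2
        \<le> 2 * (u (fst z) - u (snd z))\<^sup>2 + 2 * (v (fst z) - v (snd z))\<^sup>2"
        using sq[of "u (fst z) - u (snd z)" "v (fst z) - v (snd z)"] by (simp add: algebra_simps)
      from divide_right_mono[OF this, of "dist (fst z) (snd z) powr (real DIM('a) + 2 * s)"]
      show "norm (((u (fst z) - v (fst z)) - (u (snd z) - v (snd z)))\<^sup>2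
        / dist (fst z) (snd z) powr (real DIM('a) + 2 * s))
      \<le> norm (2 * ((u (fst z) - u (snd z))\<^sup>2 / dist (fst z) (snd z) powr (real DIM('a) + 2 * s))
        + 2 * ((v (fst z) - v (snd z))\<^sup>2 / dist (fst z) (snd z) powr (real DIM('a) + 2 * s)))"
        by (simp add: add_divide_distrib)
    qed
  qed measurable
  ultimately show ?thesis unfolding Hs_def by simp
qed

section \<open>Test functions are dense in the space on which dual elements act\<close>

lemma Hs_tilde_test_fun:
  assumes "0 < s" "s < 1" "test_fun \<Omega> \<phi>"
  shows "\<phi> \<in> Hs_tilde s \<Omega>"
proof -
  have "Hs_norm s (\<lambda>x. \<phi> x - \<phi> x) = 0"
    unfolding Hs_norm_def L2_norm_sq_def gagliardo_sq_def by simp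
  then show ?thesis
    unfolding Hs_tilde_def using assms test_fun_Hs by (auto intro!: exI[of _ \<phi>])
qed

text \<open>Shifting the approximants of \<open>v\<close> by \<open>\<phi>\<close> suffices. This
  makes \<open>v - \<phi>\<close> an admissible argument in the norm bound of a dual
  element.\<close>

lemma Hs_tilde_diff_test_fun:
  assumes s: "0 < s" "s < 1" and v: "v \<in> Hs_tilde s \<Omega>" and \<phi>: "test_fun \<Omega> \<phi>"
  shows "(\<lambda>x. v x - \<phi> x) \<in> Hs_tilde s \<Omega>"
proof -
  have "\<exists>\<psi>. test_fun \<Omega> \<psi> \<and> Hs_norm s (\<lambda>x. (v x - \<phi> x) - \<psi> x) < e" if e: "e > 0" for e
  proof -
    obtain \<psi> where \<psi>: "test_fun \<Omega> \<psi>" "Hs_norm s (\<lambda>x. v x - \<psi> x) < e"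
      using v e unfolding Hs_tilde_def by blast
    then show ?thesis
      using test_fun_diff[OF \<psi>(1) \<phi>] by (intro exI[of _ "\<lambda>x. \<psi> x - \<phi> x"]) simp
  qed
  moreover have "(\<lambda>x. v x - \<phi> x) \<in> Hs s"
    using v test_fun_Hs[OF s \<phi>] unfolding Hs_tilde_def by (auto intro: Hs_diff)
  ultimately show ?thesis unfolding Hs_tilde_def by blast
qed

text \<open>Each functional changes by at most a constant times
  \<open>Hs_norm s (v - \<phi>)\<close> when \<open>v\<close> is replaced by \<open>\<phi>\<close>.
  Only real numbers are added, so no triangle inequality for \<open>Hs_norm\<close> enters.\<close>

lemma Hs_tilde_dual_eqI:
  assumes s: "0 < s" "s < 1"
    and F: "F1 \<in> Hs_tilde_dual s \<Omega>" "F2 \<in> Hs_tilde_dual s \<Omega>"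
    and eq: "\<And>\<phi>. test_fun \<Omega> \<phi> \<Longrightarrow> F1 \<phi> = F2 \<phi>"
    and v: "v \<in> Hs_tilde s \<Omega>"
  shows "F1 v = F2 v"
proof -
  have dual: "\<exists>C>0. \<forall>\<phi>. test_fun \<Omega> \<phi> \<longrightarrow> \<bar>F v - F \<phi>\<bar> \<le> C * Hs_norm s (\<lambda>x. v x - \<phi> x)"
    if F: "F \<in> Hs_tilde_dual s \<Omega>" for F
  proof -
    obtain C where C: "\<And>u. u \<in> Hs_tilde s \<Omega> \<Longrightarrow> \<bar>F u\<bar> \<le> C * Hs_norm s u"
      using F unfolding Hs_tilde_dual_def by blast
    \<comment> \<open>The bound of a dual element may carry any real \<open>C\<close>; a positive
      constant is wanted for the later division by \<open>C1 + C2\<close>.\<close>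
    have "\<bar>F v - F \<phi>\<bar> \<le> (\<bar>C\<bar> + 1) * Hs_norm s (\<lambda>x. v x - \<phi> x)" if \<phi>: "test_fun \<Omega> \<phi>" for \<phi>
    proof -
      have "F (\<lambda>x. 1 * v x + (- 1) * \<phi> x) = 1 * F v + (- 1) * F \<phi>"
        using F v Hs_tilde_test_fun[OF s \<phi>] unfolding Hs_tilde_dual_def by blast
      then have "\<bar>F v - F \<phi>\<bar> \<le> C * Hs_norm s (\<lambda>x. v x - \<phi> x)"
        using C[OF Hs_tilde_diff_test_fun[OF s v \<phi>]] by simp
      also have "\<dots> \<le> (\<bar>C\<bar> + 1) * Hs_norm s (\<lambda>x. v x - \<phi> x)"
        unfolding Hs_norm_def L2_norm_sq_def gagliardo_sq_def
        by (intro mult_right_mono real_sqrt_ge_zero add_nonneg_nonneg integral_nonneg_AE AE_I2) auto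
      finally show ?thesis .
    qed
    then show ?thesis by (intro exI[of _ "\<bar>C\<bar> + 1"]) auto
  qed
  from dual[OF F(1)] dual[OF F(2)] obtain C1 C2 where C: "C1 > 0" "C2 > 0"
    "\<And>\<phi>. test_fun \<Omega> \<phi> \<Longrightarrow> \<bar>F1 v - F1 \<phi>\<bar> \<le> C1 * Hs_norm s (\<lambda>x. v x - \<phi> x)"
    "\<And>\<phi>. test_fun \<Omega> \<phi> \<Longrightarrow> \<bar>F2 v - F2 \<phi>\<bar> \<le> C2 * Hs_norm s (\<lambda>x. v x - \<phi> x)"
    by metis
  have "\<bar>F1 v - F2 v\<bar> \<le> e" if "e > 0" for e
  proof -
    have "e / (C1 + C2) > 0" using C that by simp
    then obtain \<phi> where \<phi>: "test_fun \<Omega> \<phi>" "Hs_norm s (\<lambda>x. v x - \<phi> x) < e / (C1 + C2)"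
      using v unfolding Hs_tilde_def by blast
    have "\<bar>F1 v - F2 v\<bar> \<le> (C1 + C2) * Hs_norm s (\<lambda>x. v x - \<phi> x)"
      using C(3,4)[OF \<phi>(1)] eq[OF \<phi>(1)] by (simp add: distrib_right)
    also have "\<dots> \<le> (C1 + C2) * (e / (C1 + C2))"
      using C \<phi>(2) by (intro mult_left_mono) auto
    also have "\<dots> = e" using C by simp
    finally show ?thesis .
  qed
  then have "\<bar>F1 v - F2 v\<bar> \<le> 0" by (rule field_le_epsilon) simp
  then show ?thesis by simp
qed

section \<open>The principal value integral\<close>

text \<open>Left-continuity lets rational parameters detect the Cauchy condition, and \<open>Lim\<close> takes one and the
  same junk value wherever the limit does not exist, so existence of the limit is not required.\<close>
lemma borel_measurable_Lim_at_right_0: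
  fixes F :: "real \<Rightarrow> 'b \<Rightarrow> real"
  assumes [measurable]: "\<And>t. F t \<in> borel_measurable M"
    and left: "\<And>t x. t > 0 \<Longrightarrow> ((\<lambda>t. F t x) \<longlongrightarrow> F t x) (at_left t)"
  shows "(\<lambda>x. Lim (at_right 0) (\<lambda>t. F t x)) \<in> borel_measurable M"
proof -
  define Q where "Q x \<longleftrightarrow> (\<forall>n::nat. \<exists>m::nat. \<forall>p q::rat. 0 < p \<and> real_of_rat p < 1 / real (Suc m) \<and>
    0 < q \<and> real_of_rat q < 1 / real (Suc m) \<longrightarrow> \<bar>F (real_of_rat p) x - F (real_of_rat q) x\<bar> \<le> 1 / real (Suc n))" for x
  have [measurable]: "Measurable.pred M Q"
  proof -
    have [measurable]: "Measurable.pred M (\<lambda>x. \<bar>F a x - F b x\<bar> \<le> c)" for a b c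
      by measurable
    have "Measurable.pred M (\<lambda>x. G \<longrightarrow> \<bar>F a x - F b x\<bar> \<le> c)" for G a b c
      by (cases G) simp_all
    then show ?thesis
      unfolding Q_def by (intro pred_intros_countable)
  qed
  \<comment> \<open>A limit along a sequence is measurable without further ado. Where
    \<open>Q\<close> holds it agrees with the one-sided limit.\<close>
  define l where "l x = lim (\<lambda>j. F (1 / real (Suc j)) x)" for x
  have [measurable]: "l \<in> borel_measurable M"
    unfolding l_def by measurable
  \<comment> \<open>Approximating from the left keeps the rational parameter below the threshold
    that \<open>t\<close> itself satisfies.\<close>
  have approx: "\<exists>q::rat. 0 < q \<and> real_of_rat q < t \<and> \<bar>F (real_of_rat q) x - F t x\<bar> < e"
    if te: "t > 0" "e > 0" for t e x
  proof -
    have "eventually (\<lambda>u. \<bar>F u x - F t x\<bar> < e) (at_left t)"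
      using tendstoD[OF left[OF te(1)] te(2)] by (simp add: dist_real_def)
    then obtain b where b: "b < t" "\<And>u. b < u \<Longrightarrow> u < t \<Longrightarrow> \<bar>F u x - F t x\<bar> < e"
      using te(1) by (auto simp: eventually_at_left[of 0])
    obtain q where "max 0 b < real_of_rat q" "real_of_rat q < t"
      using of_rat_dense[of "max 0 b" t] b te by auto
    then show ?thesis using b(2) by (intro exI[of _ q]) auto
  qed
  have conv: "((\<lambda>t. F t x) \<longlongrightarrow> l x) (at_right 0)" if Q: "Q x" for x
  proof -
    have cauchy: "\<exists>m::nat. \<forall>t u. 0 < t \<and> t < 1 / real (Suc m) \<and> 0 < u \<and> u < 1 / real (Suc m)
        \<longrightarrow> \<bar>F t x - F u x\<bar> \<le> 1 / real (Suc n)" for n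
    proof -
      obtain m where m: "\<And>p q::rat. 0 < p \<Longrightarrow> real_of_rat p < 1 / real (Suc m) \<Longrightarrow>
          0 < q \<Longrightarrow> real_of_rat q < 1 / real (Suc m) \<Longrightarrow>
          \<bar>F (real_of_rat p) x - F (real_of_rat q) x\<bar> \<le> 1 / real (Suc n)"
      proof -
        from Q have "\<exists>m::nat. \<forall>p q::rat. 0 < p \<and> real_of_rat p < 1 / real (Suc m) \<and>
          0 < q \<and> real_of_rat q < 1 / real (Suc m) \<longrightarrow>
          \<bar>F (real_of_rat p) x - F (real_of_rat q) x\<bar> \<le> 1 / real (Suc n)"
          unfolding Q_def by (rule spec)
        then show ?thesis using that by blast
      qed
      have "\<bar>F t x - F u x\<bar> \<le> 1 / real (Suc n)"
        if tu: "0 < t" "t < 1 / real (Suc m)" "0 < u" "u < 1 / real (Suc m)" for t u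
      proof (rule field_le_epsilon)
        fix e :: real assume e: "e > 0"
        obtain p where p: "0 < p" "real_of_rat p < t" "\<bar>F (real_of_rat p) x - F t x\<bar> < e / 2"
          using approx[OF tu(1), of "e / 2"] e by auto
        obtain q where q: "0 < q" "real_of_rat q < u" "\<bar>F (real_of_rat q) x - F u x\<bar> < e / 2"
          using approx[OF tu(3), of "e / 2"] e by auto
        have "\<bar>F (real_of_rat p) x - F (real_of_rat q) x\<bar> \<le> 1 / real (Suc n)"
          using p q tu by (intro m) auto
        then show "\<bar>F t x - F u x\<bar> \<le> 1 / real (Suc n) + e" using p q by linarith
      qed
      then show ?thesis by blast
    qed
    have "Cauchy (\<lambda>j. F (1 / real (Suc j)) x)"
    proof (rule metric_CauchyI)
      fix e :: real assume e: "e > 0"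
      obtain n where n: "1 / real (Suc n) < e" using e nat_approx_posE by blast
      obtain m where m: "\<And>t u. 0 < t \<Longrightarrow> t < 1 / real (Suc m) \<Longrightarrow> 0 < u \<Longrightarrow> u < 1 / real (Suc m)
        \<Longrightarrow> \<bar>F t x - F u x\<bar> \<le> 1 / real (Suc n)" using cauchy[of n] by blast
      have "dist (F (1 / real (Suc i)) x) (F (1 / real (Suc j)) x) < e" if "i \<ge> Suc m" "j \<ge> Suc m" for i j
        using m[of "1 / real (Suc i)" "1 / real (Suc j)"] that n
        by (simp add: dist_real_def frac_less2)
      then show "\<exists>N. \<forall>i\<ge>N. \<forall>j\<ge>N. dist (F (1 / real (Suc i)) x) (F (1 / real (Suc j)) x) < e"
        by blast
    qed
    then have l: "(\<lambda>j. F (1 / real (Suc j)) x) \<longlonglongrightarrow> l x"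
      unfolding l_def by (simp add: Cauchy_convergent convergent_LIMSEQ_iff[symmetric])
    show ?thesis
    proof (rule tendstoI)
      fix e :: real assume e: "e > 0"
      obtain n where n: "1 / real (Suc n) < e" using e nat_approx_posE by blast
      obtain m where m: "\<And>t u. 0 < t \<Longrightarrow> t < 1 / real (Suc m) \<Longrightarrow> 0 < u \<Longrightarrow> u < 1 / real (Suc m)
        \<Longrightarrow> \<bar>F t x - F u x\<bar> \<le> 1 / real (Suc n)" using cauchy[of n] by blast
      have "dist (F t x) (l x) < e" if t: "0 < t" "t < 1 / real (Suc m)" for t
      proof -
        have "(\<lambda>j. \<bar>F t x - F (1 / real (Suc j)) x\<bar>) \<longlonglongrightarrow> \<bar>F t x - l x\<bar>"
          by (intro tendsto_intros l)
        moreover have "\<bar>F t x - F (1 / real (Suc j)) x\<bar> \<le> 1 / real (Suc n)" if "j \<ge> Suc m" for j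
          using that t by (intro m) (auto simp: divide_strict_left_mono)
        ultimately have "\<bar>F t x - l x\<bar> \<le> 1 / real (Suc n)"
          by (intro LIMSEQ_le_const2) auto
        then show ?thesis using n by (simp add: dist_real_def)
      qed
      then show "eventually (\<lambda>t. dist (F t x) (l x) < e) (at_right 0)"
        unfolding eventually_at_right_field by (intro exI[of _ "1 / real (Suc m)"]) auto
    qed
  qed
  have Q: "Q x" if lim: "((\<lambda>t. F t x) \<longlongrightarrow> y) (at_right 0)" for x y
    unfolding Q_def
  proof
    fix n
    define e where "e = 1 / real (Suc n)"
    have "e > 0" unfolding e_def by simp
    then have "eventually (\<lambda>t. dist (F t x) y < e / 2) (at_right 0)"
      by (intro tendstoD[OF lim]) simp
    then obtain b where b: "b > 0" "\<And>t. 0 < t \<Longrightarrow> t < b \<Longrightarrow> \<bar>F t x - y\<bar> < e / 2"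
      unfolding eventually_at_right_field dist_real_def by auto
    obtain m where m: "1 / real (Suc m) < b" using b nat_approx_posE by blast
    have "\<bar>F (real_of_rat p) x - F (real_of_rat q) x\<bar> \<le> 1 / real (Suc n)"
      if "0 < p" "real_of_rat p < 1 / real (Suc m)" "0 < q" "real_of_rat q < 1 / real (Suc m)" for p q
    proof -
      have "0 < real_of_rat p" "0 < real_of_rat q" using that by simp_all
      then have "\<bar>F (real_of_rat p) x - y\<bar> < e / 2" "\<bar>F (real_of_rat q) x - y\<bar> < e / 2"
        using b(2)[of "real_of_rat p"] b(2)[of "real_of_rat q"] that m by linarith+
      then show ?thesis unfolding e_def[symmetric] by linarith
    qed
    then show "\<exists>m. \<forall>p q::rat. 0 < p \<and> real_of_rat p < 1 / real (Suc m) \<and>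
      0 < q \<and> real_of_rat q < 1 / real (Suc m) \<longrightarrow>
      \<bar>F (real_of_rat p) x - F (real_of_rat q) x\<bar> \<le> 1 / real (Suc n)" by blast
  qed
  \<comment> \<open>Without a limit, the description defining \<open>Lim\<close> ranges over the
    constantly false predicate, so the default value does not depend on \<open>x\<close>.\<close>
  have "Lim (at_right 0) (\<lambda>t. F t x) = (if Q x then l x else (THE y::real. False))" for x
  proof (cases "Q x")
    case True
    then show ?thesis using conv by (simp add: tendsto_Lim)
  next
    case False
    then have "\<And>y. \<not> ((\<lambda>t. F t x) \<longlongrightarrow> y) (at_right 0)" using Q by blast
    then show ?thesis using False unfolding t2_space_class.Lim_def by simp
  qed
  then show ?thesis by simp
qed

text \<open>Exchanging \<open>u\<close> almost everywhere inside \<open>frac_lap_pair\<close>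
  requires measurable integrands. The truncated integrals are measurable in \<open>x\<close> by
  Fubini and left-continuous in the truncation radius, so the lemma on \<open>Lim\<close>
  applies.\<close>

lemma frac_lap_measurable:
  fixes \<phi> :: "'a::euclidean_space \<Rightarrow> real"
  assumes s: "0 < s" "s < 1" and [measurable]: "\<phi> \<in> borel_measurable borel"
    and M: "\<And>x. \<bar>\<phi> x\<bar> \<le> M"
  shows "frac_lap s \<phi> \<in> borel_measurable borel"
proof -
  define \<alpha> where "\<alpha> = real DIM('a) + 2 * s"
  define k where "k x y = (\<phi> x - \<phi> y) / dist x y powr \<alpha>" for x y
  have [measurable]: "(\<lambda>z. k (fst z) (snd z)) \<in> borel_measurable (borel \<Otimes>\<^sub>M borel)"
    unfolding k_def by measurable
  have [measurable]: "k x \<in> borel_measurable borel" for x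
    unfolding k_def by measurable
  have int: "integrable lborel (\<lambda>y. indicator {y. t \<le> dist x y} y * k x y)" if t: "t > 0" for t x
  proof (rule Bochner_Integration.integrable_bound)
    \<comment> \<open>A lower bound for \<open>min 1 ((dist x y)\<^sup>2)\<close> outside the ball
      of radius \<open>t\<close>; the factor \<open>c = 2 * M / m\<close> then covers
      \<open>|\<phi> x - \<phi> y| \<le> 2 * M\<close>.\<close>
    define m where "m = min 1 (t\<^sup>2)"
    have pos: "m > 0" unfolding m_def using t by simp
    define c where "c = 2 * M / m"
    show "integrable lborel (\<lambda>y. c * (min 1 ((dist x y)\<^sup>2) / dist x y powr \<alpha>))"
      unfolding \<alpha>_def by (intro integrable_mult_right min_one_dist_sq_powr_integrable s)
    have M0: "M \<ge> 0" using M[of 0] by linarith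
    show "AE y in lborel. norm (indicator {y. t \<le> dist x y} y * k x y)
      \<le> norm (c * (min 1 ((dist x y)\<^sup>2) / dist x y powr \<alpha>))"
    proof (intro AE_I2)
      fix y
      show "norm (indicator {y. t \<le> dist x y} y * k x y)
        \<le> norm (c * (min 1 ((dist x y)\<^sup>2) / dist x y powr \<alpha>))"
      proof (cases "t \<le> dist x y")
        case True
        have m: "m \<le> min 1 ((dist x y)\<^sup>2)"
          unfolding m_def using True t by (intro min.mono power_mono) auto
        have "\<bar>\<phi> x - \<phi> y\<bar> \<le> 2 * M" using M[of x] M[of y] by linarith
        also have "\<dots> = c * m" unfolding c_def using pos by simp
        also have "\<dots> \<le> c * min 1 ((dist x y)\<^sup>2)"
          using m M0 pos unfolding c_def by (intro mult_left_mono divide_nonneg_pos) auto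
        finally have "\<bar>\<phi> x - \<phi> y\<bar> / dist x y powr \<alpha> \<le> c * min 1 ((dist x y)\<^sup>2) / dist x y powr \<alpha>"
          by (rule divide_right_mono) simp
        moreover have "c \<ge> 0" using M0 pos unfolding c_def by simp
        ultimately show ?thesis using True unfolding k_def by (simp add: abs_mult)
      qed simp
    qed
  qed measurable
  have "(\<lambda>x. Lim (at_right 0) (\<lambda>t. \<integral>y. indicator {y. t \<le> dist x y} y * k x y \<partial>lborel)) \<in> borel_measurable borel"
  proof (rule borel_measurable_Lim_at_right_0)
    show "(\<lambda>x. \<integral>y. indicator {y. t \<le> dist x y} y * k x y \<partial>lborel) \<in> borel_measurable borel" for t
    proof (rule lborel.borel_measurable_lebesgue_integral)
      have "(\<lambda>z. (if t \<le> dist (fst z) (snd z) then 1 else 0) * k (fst z) (snd z))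
        \<in> borel_measurable (borel \<Otimes>\<^sub>M lborel)" by measurable
      then show "(\<lambda>(x, y). indicator {y. t \<le> dist x y} y * k x y) \<in> borel_measurable (borel \<Otimes>\<^sub>M lborel)"
        by (simp add: indicator_def case_prod_beta)
    qed
    fix t x assume t: "t > (0::real)"
    show "((\<lambda>t. \<integral>y. indicator {y. t \<le> dist x y} y * k x y \<partial>lborel) \<longlongrightarrow>
      (\<integral>y. indicator {y. t \<le> dist x y} y * k x y \<partial>lborel)) (at_left t)"
    proof (rule tendsto_at_left_sequentially[of "t / 2"])
      fix S :: "nat \<Rightarrow> real" assume S: "\<And>n. S n < t" "\<And>n. t / 2 < S n" "S \<longlonglongrightarrow> t"
      show "(\<lambda>n. \<integral>y. indicator {y. S n \<le> dist x y} y * k x y \<partial>lborel) \<longlonglongrightarrow>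
        (\<integral>y. indicator {y. t \<le> dist x y} y * k x y \<partial>lborel)"
      \<comment> \<open>All radii \<open>S n\<close> exceed \<open>t / 2\<close>, so truncation at
        \<open>t / 2\<close> dominates every term.\<close>
      proof (rule integral_dominated_convergence[where w = "\<lambda>y. \<bar>indicator {y. t / 2 \<le> dist x y} y * k x y\<bar>"])
        show "integrable lborel (\<lambda>y. \<bar>indicator {y. t / 2 \<le> dist x y} y * k x y\<bar>)"
          using t by (intro integrable_abs int) simp
        show "AE y in lborel. (\<lambda>n. indicator {y. S n \<le> dist x y} y * k x y) \<longlonglongrightarrow>
          indicator {y. t \<le> dist x y} y * k x y"
        proof (intro AE_I2 tendsto_mult tendsto_const)
          fix y
          \<comment> \<open>The non-strict inequality gives continuity from the left: points at
            distance exactly \<open>t\<close> belong to the limit set and to all sets with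
            \<open>S n < t\<close>.\<close>
          show "(\<lambda>n. indicator {y. S n \<le> dist x y} y :: real) \<longlonglongrightarrow> indicator {y. t \<le> dist x y} y"
          proof (cases "t \<le> dist x y")
            case True
            then have "S n \<le> dist x y" for n using S(1)[of n] by linarith
            then show ?thesis using True by simp
          next
            case False
            then have "eventually (\<lambda>n. dist x y < S n) sequentially"
              using order_tendstoD(1)[OF S(3)] by simp
            then have "eventually (\<lambda>n. indicator {y. S n \<le> dist x y} y = (0::real)) sequentially"
              by eventually_elim simp
            then show ?thesis using False by (simp add: tendsto_eventually)
          qed
        qed
        have "t / 2 \<le> dist x y" if "S n \<le> dist x y" for n y
          using S(2)[of n] that by linarith
        then show "AE y in lborel. norm (indicator {y. S n \<le> dist x y} y * k x y)
          \<le> \<bar>indicator {y. t / 2 \<le> dist x y} y * k x y\<bar>" for n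
          by (intro AE_I2) (auto simp: indicator_def)
      qed measurable
    qed (use t in auto)
  qed
  then show ?thesis unfolding frac_lap_def[abs_def] k_def \<alpha>_def by simp
qed

text \<open>Once the truncation radius is below \<open>d\<close>, only points with
  \<open>\<phi> y = 0\<close> are cut away, so the truncated integral no longer depends on it and
  the limit is trivial.\<close>

lemma frac_lap_off_support:
  fixes \<phi> :: "'a::euclidean_space \<Rightarrow> real"
  assumes d: "d > 0" "\<And>y. dist x y < d \<Longrightarrow> \<phi> y = 0"
  shows "frac_lap s \<phi> x =
    - frac_const DIM('a) s * (\<integral>y. \<phi> y / dist x y powr (real DIM('a) + 2 * s) \<partial>lborel)"
proof -
  let ?\<alpha> = "real DIM('a) + 2 * s"
  have "Lim (at_right 0) (\<lambda>t. \<integral>y. indicator {y. t \<le> dist x y} y * ((\<phi> x - \<phi> y) / dist x y powr ?\<alpha>) \<partial>lborel)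
    = - (\<integral>y. \<phi> y / dist x y powr ?\<alpha> \<partial>lborel)"
  proof (rule tendsto_Lim[OF _ tendsto_eventually])
    have "(\<integral>y. indicator {y. t \<le> dist x y} y * ((\<phi> x - \<phi> y) / dist x y powr ?\<alpha>) \<partial>lborel)
      = - (\<integral>y. \<phi> y / dist x y powr ?\<alpha> \<partial>lborel)" if t: "0 < t" "t < d" for t
      unfolding Bochner_Integration.integral_minus[symmetric]
    proof (rule Bochner_Integration.integral_cong[OF refl])
      show "indicator {y. t \<le> dist x y} y * ((\<phi> x - \<phi> y) / dist x y powr ?\<alpha>)
        = - (\<phi> y / dist x y powr ?\<alpha>)" for y
        using d(2)[of x] d(1) d(2)[of y] t by (auto simp: indicator_def)
    qed
    then show "eventually (\<lambda>t. (\<integral>y. indicator {y. t \<le> dist x y} y * ((\<phi> x - \<phi> y) / dist x y powr ?\<alpha>) \<partial>lborel)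
      = - (\<integral>y. \<phi> y / dist x y powr ?\<alpha> \<partial>lborel)) (at_right 0)"
      unfolding eventually_at_right_field using d(1) by blast
  qed simp
  then show ?thesis unfolding frac_lap_def by simp
qed

text \<open>\<open>Gamma\<close> is 0 by convention exactly at its poles, and \<open>- s\<close>
  lies strictly between the poles -1 and 0.\<close>

lemma frac_const_nonzero:
  assumes "0 < s" "s < 1"
  shows "frac_const n s \<noteq> 0"
proof -
  have "- s \<notin> \<int>\<^sub>\<le>\<^sub>0"
  proof
    assume "- s \<in> \<int>\<^sub>\<le>\<^sub>0"
    then obtain m :: int where "- s = of_int m" by (auto elim: nonpos_Ints_cases)
    then have "-1 < m" "m < 0" using assms by linarith+
    then show False by simp
  qed
  then have "Gamma (- s) \<noteq> 0" by (simp add: Gamma_eq_zero_iff)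
  moreover have "Gamma (real n / 2 + s) > 0" using assms by (intro Gamma_real_pos) auto
  ultimately show ?thesis unfolding frac_const_def by simp
qed

section \<open>Bump functions\<close>

text \<open>The classical flat function is the case \<open>k = 0\<close>. The negative powers of
  \<open>t\<close> are included so that derivatives are linear combinations of members of the same
  family.\<close>

definition flat_exp :: "nat \<Rightarrow> real \<Rightarrow> real" where
  "flat_exp k t = (if t > 0 then exp (- inverse t) * inverse t ^ k else 0)"

lemma flat_exp_tendsto_0: "(flat_exp k \<longlongrightarrow> 0) (at_right 0)"
proof -
  have "((\<lambda>t::real. inverse t ^ k / exp (inverse t)) \<longlongrightarrow> 0) (at_right 0)"
    using tendsto_power_div_exp_0 filterlim_inverse_at_top_right by (rule filterlim_compose)
  then show ?thesis
  proof (rule Lim_transform_eventually)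
    show "eventually (\<lambda>t. inverse t ^ k / exp (inverse t) = flat_exp k t) (at_right 0)"
      unfolding eventually_at_right_field flat_exp_def
      by (intro exI[of _ 1]) (auto simp: exp_minus divide_inverse)
  qed
qed

lemma flat_exp_has_derivative:
  "(flat_exp k has_real_derivative (flat_exp (k + 2) t - real k * flat_exp (k + 1) t)) (at t)"
proof -
  consider "t > 0" | "t < 0" | "t = 0" by linarith
  then show ?thesis
  proof cases
    case 1
    have "((\<lambda>t. inverse t ^ k) has_real_derivative - real k * inverse t ^ (k + 1)) (at t)"
    proof (rule DERIV_power[OF DERIV_inverse, THEN DERIV_cong])
      show "real k * (- (inverse t ^ Suc (Suc 0)) * inverse t ^ (k - Suc 0))
          = - real k * inverse t ^ (k + 1)"
        by (cases k) (simp_all add: algebra_simps)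
    qed (use 1 in simp)
    moreover have "((\<lambda>t. exp (- inverse t)) has_real_derivative exp (- inverse t) * inverse t ^ 2) (at t)"
      using 1 by (auto intro!: derivative_eq_intros simp: power2_eq_square)
    ultimately have "((\<lambda>t. exp (- inverse t) * inverse t ^ k) has_real_derivative
        exp (- inverse t) * inverse t ^ 2 * inverse t ^ k
          + - real k * inverse t ^ (k + 1) * exp (- inverse t)) (at t)"
      by (intro DERIV_mult)
    also have "exp (- inverse t) * inverse t ^ 2 * inverse t ^ k
          + - real k * inverse t ^ (k + 1) * exp (- inverse t)
        = flat_exp (k + 2) t - real k * flat_exp (k + 1) t"
      using 1 by (simp add: flat_exp_def power_add power2_eq_square mult_ac)
    finally have "((\<lambda>t. exp (- inverse t) * inverse t ^ k) has_real_derivative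
        (flat_exp (k + 2) t - real k * flat_exp (k + 1) t)) (at t)" .
    then show ?thesis
      by (rule has_field_derivative_transform_within_open[of _ _ _ "{0<..}"])
        (use 1 in \<open>auto simp: flat_exp_def\<close>)
  next
    case 2
    have "((\<lambda>t. 0) has_real_derivative 0) (at t)" by simp
    then have "(flat_exp k has_real_derivative 0) (at t)"
      by (rule has_field_derivative_transform_within_open[of _ _ _ "{..<0}"])
        (use 2 in \<open>auto simp: flat_exp_def\<close>)
    then show ?thesis using 2 by (simp add: flat_exp_def)
  next
    case 3
    \<comment> \<open>At the origin the difference quotient is the next member of the family, which
      tends to 0 from both sides.\<close>
    have q: "(flat_exp k h - flat_exp k 0) / h = flat_exp (k + 1) h" for h
      by (auto simp: flat_exp_def divide_inverse)
    have "(flat_exp (k + 1) \<longlongrightarrow> 0) (at_left 0)"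
      by (rule tendsto_eventually) (auto simp: eventually_at_left_field flat_exp_def intro!: exI[of _ "-1"])
    then have "(flat_exp (k + 1) \<longlongrightarrow> 0) (at 0)"
      using flat_exp_tendsto_0 by (intro filterlim_split_at)
    then have "(flat_exp k has_real_derivative 0) (at 0)"
      unfolding has_field_derivative_iff by (simp add: q)
    then show ?thesis using 3 by (simp add: flat_exp_def)
  qed
qed

text \<open>Built to be the class that \<open>smooth_fun\<close> asks for: it contains the bump and
  is closed under directional derivatives. The linear functions arise from the chain rule for
  \<open>|x - a|^2\<close>.\<close>

inductive bump_class :: "'a::euclidean_space \<Rightarrow> real \<Rightarrow> ('a \<Rightarrow> real) \<Rightarrow> bool"
  for a :: 'a and r :: real where
  const: "bump_class a r (\<lambda>x. c)"
| inner: "bump_class a r (\<lambda>x. (x - a) \<bullet> b)"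
| flat: "bump_class a r (\<lambda>x. flat_exp k (r\<^sup>2 - (x - a) \<bullet> (x - a)))"
| add: "bump_class a r f \<Longrightarrow> bump_class a r g \<Longrightarrow> bump_class a r (\<lambda>x. f x + g x)"
| mult: "bump_class a r f \<Longrightarrow> bump_class a r g \<Longrightarrow> bump_class a r (\<lambda>x. f x * g x)"

lemma bump_class_derivative:
  assumes "bump_class a r f"
  shows "\<exists>f'. (\<forall>x. (f has_derivative f' x) (at x)) \<and> (\<forall>b. bump_class a r (\<lambda>x. f' x b))"
  using assms
proof induction
  case (const c)
  then show ?case by (intro exI[of _ "\<lambda>x v. 0"]) (auto intro: bump_class.const)
next
  case (inner b)
  show ?case
    by (intro exI[of _ "\<lambda>x v. v \<bullet> b"] conjI allI)
      (auto intro!: bump_class.const derivative_eq_intros)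
next
  case (flat k)
  let ?p = "\<lambda>x. r\<^sup>2 - (x - a) \<bullet> (x - a)"
  let ?f' = "\<lambda>x v. (flat_exp (k + 2) (?p x) + - real k * flat_exp (k + 1) (?p x)) * (- 2 * ((x - a) \<bullet> v))"
  have "((\<lambda>x. flat_exp k (?p x)) has_derivative ?f' x) (at x)" for x
  proof -
    have "(?p has_derivative (\<lambda>v. - 2 * ((x - a) \<bullet> v))) (at x)"
      by (auto intro!: derivative_eq_intros simp: inner_commute)
    from has_derivative_compose[OF this flat_exp_has_derivative[unfolded has_field_derivative_def]]
    show ?thesis by (simp add: mult.commute)
  qed
  moreover have "bump_class a r (\<lambda>x. ?f' x b)" for b
    by (intro bump_class.intros)
  ultimately show ?case by (intro exI[of _ ?f']) blast
next
  case (add f g)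
  then obtain f' g' where "\<And>x. (f has_derivative f' x) (at x)" "\<And>b. bump_class a r (\<lambda>x. f' x b)"
    "\<And>x. (g has_derivative g' x) (at x)" "\<And>b. bump_class a r (\<lambda>x. g' x b)" by metis
  then show ?case
    by (intro exI[of _ "\<lambda>x v. f' x v + g' x v"]) (auto intro: bump_class.add has_derivative_add)
next
  case (mult f g)
  then obtain f' g' where "\<And>x. (f has_derivative f' x) (at x)" "\<And>b. bump_class a r (\<lambda>x. f' x b)"
    "\<And>x. (g has_derivative g' x) (at x)" "\<And>b. bump_class a r (\<lambda>x. g' x b)" by metis
  then show ?case using mult.hyps
    by (intro exI[of _ "\<lambda>x v. f x * g' x v + f' x v * g x"])
      (auto intro!: bump_class.add bump_class.mult has_derivative_mult)
qed

lemma bump_class_smooth: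
  assumes "bump_class a r f"
  shows "smooth_fun f"
proof -
  have "(\<forall>x. g differentiable (at x)) \<and> (\<forall>b\<in>Basis. bump_class a r (\<lambda>x. frechet_derivative g (at x) b))"
    if g: "bump_class a r g" for g
  proof -
    obtain g' where g': "\<And>x. (g has_derivative g' x) (at x)" "\<And>b. bump_class a r (\<lambda>x. g' x b)"
      using bump_class_derivative[OF g] by blast
    have "frechet_derivative g (at x) = g' x" for x
      using frechet_derivative_at[OF g'(1)] by metis
    then show ?thesis using g' by (auto simp: differentiable_def)
  qed
  then show ?thesis
    unfolding smooth_fun_def using assms by (intro exI[of _ "Collect (bump_class a r)"]) auto
qed

text \<open>Positivity on the whole open ball makes the integral of the bump positive, so that it
  can be normalized.\<close>

lemma exists_bump_test_fun:
  fixes a :: "'a::euclidean_space"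
  assumes r: "r > 0" "cball a r \<subseteq> U"
  obtains \<phi> where "test_fun U \<phi>" "\<And>x. \<phi> x \<ge> 0" "\<And>x. x \<in> ball a r \<longleftrightarrow> \<phi> x > 0"
proof
  define \<phi> where "\<phi> x = flat_exp 0 (r\<^sup>2 - (x - a) \<bullet> (x - a))" for x
  have iff: "0 < r\<^sup>2 - (x - a) \<bullet> (x - a) \<longleftrightarrow> x \<in> ball a r" for x
  proof -
    have "(x - a) \<bullet> (x - a) = (dist a x)\<^sup>2"
      by (metis dist_commute dist_norm power2_norm_eq_inner)
    moreover have "(dist a x)\<^sup>2 < r\<^sup>2 \<longleftrightarrow> dist a x < r"
      using r by (simp add: power_mono_iff flip: not_le)
    ultimately show ?thesis by simp
  qed
  show pos: "x \<in> ball a r \<longleftrightarrow> \<phi> x > 0" for x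
    unfolding \<phi>_def flat_exp_def iff by simp
  show nn: "\<phi> x \<ge> 0" for x
    unfolding \<phi>_def flat_exp_def by simp
  have "\<phi> x = 0" if "x \<notin> cball a r" for x
    using that pos[of x] nn[of x] by (auto simp: order_less_le)
  moreover have "smooth_fun \<phi>"
    unfolding \<phi>_def[abs_def] by (rule bump_class_smooth[OF bump_class.flat])
  ultimately show "test_fun U \<phi>"
    unfolding test_fun_def using r by (intro conjI exI[of _ "cball a r"]) auto
qed

section \<open>Unique continuation from the exterior\<close>

text \<open>Applied to normalized bumps in two ways: with \<open>v\<close> the kernel value at the
  centre, for convergence of the averages, and with \<open>v = 0\<close>, for their uniform
  bound.\<close>

lemma weighted_average_approx:
  fixes h \<phi> :: "'a::euclidean_space \<Rightarrow> real"
  assumes \<phi>: "integrable lborel \<phi>" "\<And>y. \<phi> y \<ge> 0" "\<And>y. y \<notin> S \<Longrightarrow> \<phi> y = 0"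
    and pos: "(\<integral>y. \<phi> y \<partial>lborel) > 0"
    and h: "h \<in> borel_measurable borel" "\<And>y. y \<in> S \<Longrightarrow> \<bar>h y - v\<bar> \<le> e"
  shows "\<bar>(\<integral>y. \<phi> y * h y \<partial>lborel) / (\<integral>y. \<phi> y \<partial>lborel) - v\<bar> \<le> e"
proof -
  let ?I = "\<integral>y. \<phi> y \<partial>lborel"
  have b: "\<bar>\<phi> y * (h y - v)\<bar> \<le> e * \<phi> y" for y
    using h(2)[of y] \<phi>(2)[of y] \<phi>(3)[of y]
    by (cases "y \<in> S") (auto simp: abs_mult mult.commute[of e] intro!: mult_left_mono)
  have int: "integrable lborel (\<lambda>y. \<phi> y * (h y - v))"
  proof (rule Bochner_Integration.integrable_bound)
    show "integrable lborel (\<lambda>y. e * \<phi> y)" using \<phi>(1) by simp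
    show "(\<lambda>y. \<phi> y * (h y - v)) \<in> borel_measurable lborel"
      using borel_measurable_integrable[OF \<phi>(1)] h(1) by simp
    show "AE y in lborel. norm (\<phi> y * (h y - v)) \<le> norm (e * \<phi> y)"
      using order_trans[OF b abs_ge_self] by (intro AE_I2) simp
  qed
  have "integrable lborel (\<lambda>y. \<phi> y * (h y - v) + v * \<phi> y)"
    using int \<phi>(1) by simp
  then have "(\<integral>y. \<phi> y * h y \<partial>lborel) = (\<integral>y. \<phi> y * (h y - v) + v * \<phi> y \<partial>lborel)"
    by (intro Bochner_Integration.integral_cong) (auto simp: algebra_simps)
  also have "\<dots> = (\<integral>y. \<phi> y * (h y - v) \<partial>lborel) + v * ?I"
    using int \<phi>(1) by simp
  finally have "(\<integral>y. \<phi> y * h y \<partial>lborel) / ?I - v = (\<integral>y. \<phi> y * (h y - v) \<partial>lborel) / ?I"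
    using pos by (simp add: field_simps)
  moreover have "\<bar>\<integral>y. \<phi> y * (h y - v) \<partial>lborel\<bar> \<le> e * ?I"
  proof -
    have "\<bar>\<integral>y. \<phi> y * (h y - v) \<partial>lborel\<bar> \<le> (\<integral>y. \<bar>\<phi> y * (h y - v)\<bar> \<partial>lborel)"
      by (rule integral_abs_bound)
    also have "\<dots> \<le> (\<integral>y. e * \<phi> y \<partial>lborel)"
      using int \<phi>(1) b by (intro integral_mono integrable_abs) auto
    finally show ?thesis by simp
  qed
  ultimately show ?thesis
    using pos by (simp add: abs_divide divide_le_eq)
qed

section \<open>Test functions and their potentials\<close>

lemma
  fixes \<phi> :: "'a::euclidean_space \<Rightarrow> real"
  assumes "test_fun U \<phi>"
  shows test_fun_measurable: "\<phi> \<in> borel_measurable borel"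
    and test_fun_bounded: "\<exists>M. \<forall>x. \<bar>\<phi> x\<bar> \<le> M"
    and test_fun_integrable: "integrable lborel \<phi>"
proof -
  obtain K where sm: "smooth_fun \<phi>" and K: "compact K" "\<And>x. x \<notin> K \<Longrightarrow> \<phi> x = 0"
    using assms unfolding test_fun_def by blast
  show meas: "\<phi> \<in> borel_measurable borel"
    using smooth_fun_continuous[OF sm] by (rule borel_measurable_continuous_onI)
  obtain M where M: "M > 0" "\<And>x. \<bar>\<phi> x\<bar> \<le> M"
    using continuous_compact_support_bounded[OF smooth_fun_continuous[OF sm] K] by metis
  then show "\<exists>M. \<forall>x. \<bar>\<phi> x\<bar> \<le> M" by blast
  show "integrable lborel \<phi>"
  proof (rule Bochner_Integration.integrable_bound)
    show "integrable lborel (\<lambda>x. M * indicator K x)"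
      using emeasure_bounded_finite[OF compact_imp_bounded[OF K(1)]] K(1)
      by (intro integrable_mult_right integrable_real_indicator) (auto intro: borel_closed compact_imp_closed)
    show "AE x in lborel. norm (\<phi> x) \<le> norm (M * indicator K x :: real)"
      using M K(2) by (intro AE_I2) (auto simp: indicator_def)
  qed (use meas in simp)
qed

lemma dist_powr_bounded:
  fixes K L :: "'a::euclidean_space set"
  assumes "compact K" "compact L" "K \<inter> L = {}"
  obtains B where "\<And>x y. x \<in> K \<Longrightarrow> y \<in> L \<Longrightarrow> \<bar>1 / dist x y powr \<alpha>\<bar> \<le> B"
proof -
  let ?f = "\<lambda>z. 1 / dist (fst z) (snd z) powr \<alpha>"
  have "continuous_on (K \<times> L) ?f"
    using assms by (intro continuous_intros) auto
  then have "bounded (?f ` (K \<times> L))"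
    using assms by (intro compact_imp_bounded compact_continuous_image compact_Times)
  then obtain B where "\<forall>v\<in>?f ` (K \<times> L). \<bar>v\<bar> \<le> B"
    unfolding bounded_real by blast
  then show thesis by (intro that[of B]) force
qed

lemma kernel_potential_measurable:
  fixes \<phi> :: "'a::euclidean_space \<Rightarrow> real"
  assumes [measurable]: "\<phi> \<in> borel_measurable borel"
  shows "(\<lambda>x. \<integral>y. \<phi> y / dist x y powr \<alpha> \<partial>lborel) \<in> borel_measurable borel"
proof (rule lborel.borel_measurable_lebesgue_integral)
  have "(\<lambda>z. \<phi> (snd z) / dist (fst z) (snd z) powr \<alpha>) \<in> borel_measurable (borel \<Otimes>\<^sub>M lborel)"
    by measurable
  then show "(\<lambda>(x, y). \<phi> y / dist x y powr \<alpha>) \<in> borel_measurable (borel \<Otimes>\<^sub>M lborel)"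
    by (simp add: case_prod_beta)
qed

context compact_density
begin

text \<open>Passes from vanishing in the distributional sense to vanishing at a point: normalized
  bumps shrinking to \<open>x0\<close> form an approximate identity, and their averages of the
  kernel converge boundedly on \<open>K\<close>.\<close>

lemma pairing_kernel_eq_0:
  fixes W :: "'a set"
  assumes W: "open W" "W \<inter> K = {}"
    and zero: "\<And>\<phi>. test_fun W \<phi> \<Longrightarrow> pairing (\<lambda>x. \<integral>y. \<phi> y / dist x y powr \<alpha> \<partial>lborel) = 0"
    and x0: "x0 \<in> W"
  shows "pairing (\<lambda>x. 1 / dist x x0 powr \<alpha>) = 0"
proof -
  obtain r where r: "r > 0" "cball x0 r \<subseteq> W"
    using W(1) x0 open_contains_cball by blast
  define \<rho> where "\<rho> n = r / real (Suc n)" for n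
  have \<rho>: "\<rho> n > 0" "\<rho> n \<le> r" for n
    unfolding \<rho>_def using r by (auto simp: field_simps)
  have \<rho>0: "\<rho> \<longlonglongrightarrow> 0"
    unfolding \<rho>_def using LIMSEQ_Suc[OF lim_const_over_n] by simp
  have sub: "ball x0 (\<rho> n) \<subseteq> cball x0 r" "cball x0 (\<rho> n) \<subseteq> W" for n
    using \<rho>[of n] r by (auto simp: subset_iff)
  have "\<exists>\<phi>. test_fun W \<phi> \<and> (\<forall>x. \<phi> x \<ge> 0) \<and> (\<forall>x. x \<in> ball x0 (\<rho> n) \<longleftrightarrow> \<phi> x > 0)" for n
    using exists_bump_test_fun[OF \<rho>(1) sub(2)] by metis
  then obtain \<phi> where \<phi>: "\<And>n. test_fun W (\<phi> n)" "\<And>n x. \<phi> n x \<ge> 0"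
    "\<And>n x. x \<in> ball x0 (\<rho> n) \<longleftrightarrow> \<phi> n x > 0" by metis
  have \<phi>0: "\<phi> n x = 0" if "x \<notin> ball x0 (\<rho> n)" for n x
    using \<phi>(2)[of n x] \<phi>(3)[of x n] that by (auto simp: order_less_le)
  define c where "c n = (\<integral>y. \<phi> n y \<partial>lborel)" for n
  have c: "c n > 0" for n
  proof -
    have "c n \<noteq> 0"
    proof
      assume "c n = 0"
      then have "AE y in lborel. \<phi> n y = 0"
        unfolding c_def using \<phi>(2) test_fun_integrable[OF \<phi>(1)]
        by (subst (asm) integral_nonneg_eq_0_iff_AE) auto
      then have "AE y in lborel. y \<notin> ball x0 (\<rho> n)"
        by eventually_elim (use \<phi>(3) in force)
      then have "emeasure lborel (ball x0 (\<rho> n)) = 0"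
        by (subst (asm) AE_iff_measurable[OF _ refl]) (auto simp: ball_def)
      then show False using \<rho>(1)[of n] unit_ball_vol_pos[of "real DIM('a)"] by (simp add: emeasure_ball)
    qed
    moreover have "c n \<ge> 0" unfolding c_def using \<phi>(2) by simp
    ultimately show ?thesis by simp
  qed
  obtain B where B: "\<And>x y. x \<in> K \<Longrightarrow> y \<in> cball x0 r \<Longrightarrow> \<bar>1 / dist x y powr \<alpha>\<bar> \<le> B"
    using dist_powr_bounded[OF compact_K compact_cball, of x0 r \<alpha>] W r by blast
  \<comment> \<open>The average of the kernel against the normalized bump of radius
    \<open>\<rho> n\<close>.\<close>
  define f where "f n x = (\<integral>y. \<phi> n y * (1 / dist x y powr \<alpha>) \<partial>lborel) / c n" for n x
  have avg: "\<bar>f n x - v\<bar> \<le> e"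
    if "\<And>y. y \<in> ball x0 (\<rho> n) \<Longrightarrow> \<bar>1 / dist x y powr \<alpha> - v\<bar> \<le> e" for n x v e
    unfolding f_def c_def
    by (rule weighted_average_approx[where S = "ball x0 (\<rho> n)"])
      (use that c test_fun_integrable[OF \<phi>(1)] \<phi>(2) \<phi>0 in \<open>auto simp: c_def\<close>)
  have "(\<lambda>n. pairing (f n)) \<longlonglongrightarrow> pairing (\<lambda>x. 1 / dist x x0 powr \<alpha>)"
  proof (rule pairing_dominated_convergence[where B = B])
    have "f n \<in> borel_measurable borel" for n
      using kernel_potential_measurable[OF test_fun_measurable[OF \<phi>(1)], of n \<alpha>]
      unfolding f_def by simp
    then show "(\<lambda>y. w y * f n y) \<in> borel_measurable borel" for n
      using borel_measurable_integrable[OF integrable_w] by simp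
    have "continuous_on K (\<lambda>x. 1 / dist x x0 powr \<alpha>)"
      using W x0 by (intro continuous_intros) auto
    then show "(\<lambda>x. w x * (1 / dist x x0 powr \<alpha>)) \<in> borel_measurable borel"
      by (rule measurable_pairing)
    show "\<bar>f n x\<bar> \<le> B" if x: "x \<in> K" for n x
    proof -
      have "\<bar>f n x - 0\<bar> \<le> B"
      proof (rule avg)
        fix y assume "y \<in> ball x0 (\<rho> n)"
        with sub(1) have "y \<in> cball x0 r" by blast
        from B[OF x this] show "\<bar>1 / dist x y powr \<alpha> - 0\<bar> \<le> B" by simp
      qed
      then show ?thesis by simp
    qed
    show "(\<lambda>n. f n x) \<longlonglongrightarrow> 1 / dist x x0 powr \<alpha>" if x: "x \<in> K" for x
    proof (rule LIMSEQ_I)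
      fix e :: real assume e: "e > 0"
      have "x \<noteq> x0" using x x0 W by auto
      then have "isCont (\<lambda>y. 1 / dist x y powr \<alpha>) x0"
        by (intro continuous_intros) auto
      then obtain d where d: "d > 0"
        "\<And>y. dist y x0 < d \<Longrightarrow> dist (1 / dist x y powr \<alpha>) (1 / dist x x0 powr \<alpha>) < e / 2"
        unfolding continuous_at_eps_delta using half_gt_zero[OF e] by blast
      obtain N where N: "\<And>n. n \<ge> N \<Longrightarrow> \<rho> n < d"
        using order_tendstoD(2)[OF \<rho>0 d(1)] unfolding eventually_sequentially by blast
      have "norm (f n x - 1 / dist x x0 powr \<alpha>) < e" if n: "n \<ge> N" for n
      proof -
        have "\<bar>f n x - 1 / dist x x0 powr \<alpha>\<bar> \<le> e / 2"
        proof (rule avg)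
          fix y assume "y \<in> ball x0 (\<rho> n)"
          then have "dist y x0 < d" using N[OF n] by (simp add: dist_commute)
          from d(2)[OF this] show "\<bar>1 / dist x y powr \<alpha> - 1 / dist x x0 powr \<alpha>\<bar> \<le> e / 2"
            by (simp add: dist_real_def)
        qed
        then show ?thesis using e by simp
      qed
      then show "\<exists>N. \<forall>n\<ge>N. norm (f n x - 1 / dist x x0 powr \<alpha>) < e" by blast
    qed
  qed
  moreover have "pairing (f n) = 0" for n
  proof -
    have "f n = (\<lambda>x. inverse (c n) * (\<integral>y. \<phi> n y / dist x y powr \<alpha> \<partial>lborel))"
      unfolding f_def by (simp add: divide_inverse mult.commute)
    then show ?thesis using zero[OF \<phi>(1)] by (simp add: pairing_cmult)
  qed
  ultimately show ?thesis by (simp add: LIMSEQ_const_iff)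
qed

text \<open>Boundedness on \<open>K\<close>, together with measurability, makes density times
  potential integrable, as needed to split a pairing into a difference.\<close>

lemma kernel_potential_bounded:
  assumes W: "W \<inter> K = {}" and \<phi>: "test_fun W \<phi>"
  shows "\<exists>B. \<forall>x\<in>K. \<bar>\<integral>y. \<phi> y / dist x y powr \<alpha> \<partial>lborel\<bar> \<le> B"
proof -
  obtain L where L: "compact L" "L \<subseteq> W" "\<And>y. y \<notin> L \<Longrightarrow> \<phi> y = 0"
    using \<phi> unfolding test_fun_def by blast
  obtain B where B: "\<And>x y. x \<in> K \<Longrightarrow> y \<in> L \<Longrightarrow> \<bar>1 / dist x y powr \<alpha>\<bar> \<le> B"
    using dist_powr_bounded[OF compact_K L(1), of \<alpha>] W L(2) by blast
  have [measurable]: "\<phi> \<in> borel_measurable borel" by (rule test_fun_measurable[OF \<phi>])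
  have "\<bar>\<integral>y. \<phi> y / dist x y powr \<alpha> \<partial>lborel\<bar> \<le> (\<integral>y. B * \<bar>\<phi> y\<bar> \<partial>lborel)" if x: "x \<in> K" for x
  proof -
    have b: "\<bar>\<phi> y / dist x y powr \<alpha>\<bar> \<le> B * \<bar>\<phi> y\<bar>" for y
      using B[OF x, of y] L(3)[of y] mult_right_mono[OF B[OF x, of y], of "\<bar>\<phi> y\<bar>"]
      by (cases "y \<in> L") (auto simp: abs_mult)
    have int: "integrable lborel (\<lambda>y. B * \<bar>\<phi> y\<bar>)"
      using test_fun_integrable[OF \<phi>] by simp
    have "integrable lborel (\<lambda>y. \<phi> y / dist x y powr \<alpha>)"
    proof (rule Bochner_Integration.integrable_bound[OF int])
      show "AE y in lborel. norm (\<phi> y / dist x y powr \<alpha>) \<le> norm (B * \<bar>\<phi> y\<bar>)"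
        using order_trans[OF b abs_ge_self] by (intro AE_I2) simp
    qed measurable
    then have "(\<integral>y. \<bar>\<phi> y / dist x y powr \<alpha>\<bar> \<partial>lborel) \<le> (\<integral>y. B * \<bar>\<phi> y\<bar> \<partial>lborel)"
      using b int by (intro integral_mono integrable_abs) auto
    then show ?thesis by (rule order_trans[OF integral_abs_bound])
  qed
  then show ?thesis by blast
qed

text \<open>Each point of \<open>K\<close> has a positive distance from the support of
  \<open>\<phi>\<close>, so the principal value there is an ordinary integral; off \<open>K\<close>
  the density is 0, whatever value \<open>frac_lap s \<phi>\<close> takes.\<close>

lemma frac_lap_pair_eq_pairing:
  assumes s: "0 < s" "s < 1" and W: "W \<inter> K = {}" and \<phi>: "test_fun W \<phi>"
    and u: "u \<in> borel_measurable borel" "AE x in lborel. u x = w x"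
  shows "frac_lap_pair s u \<phi> = - frac_const DIM('a) s *
    pairing (\<lambda>x. \<integral>y. \<phi> y / dist x y powr (real DIM('a) + 2 * s) \<partial>lborel)"
proof -
  obtain L where L: "compact L" "L \<subseteq> W" "\<And>y. y \<notin> L \<Longrightarrow> \<phi> y = 0"
    using \<phi> unfolding test_fun_def by blast
  obtain M where M: "\<And>x. \<bar>\<phi> x\<bar> \<le> M" using test_fun_bounded[OF \<phi>] by blast
  have [measurable]: "frac_lap s \<phi> \<in> borel_measurable borel"
    by (rule frac_lap_measurable[OF s test_fun_measurable[OF \<phi>] M])
  have [measurable]: "w \<in> borel_measurable borel" "u \<in> borel_measurable borel"
    using borel_measurable_integrable[OF integrable_w] u(1) by simp_all
  have "frac_lap_pair s u \<phi> = pairing (frac_lap s \<phi>)"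
    unfolding frac_lap_pair_def pairing_def
  proof (rule integral_cong_AE)
    show "AE x in lborel. u x * frac_lap s \<phi> x = w x * frac_lap s \<phi> x"
      using u(2) by eventually_elim simp
  qed measurable
  also have "\<dots> = pairing (\<lambda>x. - frac_const DIM('a) s *
      (\<integral>y. \<phi> y / dist x y powr (real DIM('a) + 2 * s) \<partial>lborel))"
  proof (rule pairing_cong)
    fix x assume "x \<in> K"
    then have "x \<in> - L" using L(2) W by auto
    moreover have "open (- L)" using L(1) by (simp add: compact_imp_closed open_Compl)
    ultimately obtain d where "d > 0" "ball x d \<subseteq> - L"
      unfolding open_contains_ball by blast
    then show "frac_lap s \<phi> x = - frac_const DIM('a) s *
        (\<integral>y. \<phi> y / dist x y powr (real DIM('a) + 2 * s) \<partial>lborel)"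
      using L(3) by (intro frac_lap_off_support[of d]) auto
  qed
  finally show ?thesis by (simp only: pairing_cmult)
qed

end

text \<open>Square integrability gives integrability on a set of finite measure, by
  \<open>|t| \<le> 1 + t^2\<close>.\<close>

lemma Hs_compact_density:
  fixes u :: "'a::euclidean_space \<Rightarrow> real"
  assumes "u \<in> Hs s" "compact K"
  shows "compact_density (\<lambda>x. indicator K x * u x) K"
proof
  have [measurable]: "u \<in> borel_measurable borel" and u2: "integrable lborel (\<lambda>x. (u x)\<^sup>2)"
    using assms(1) unfolding Hs_def by auto
  have [measurable]: "K \<in> sets borel" using assms(2) by (intro borel_closed compact_imp_closed)
  have K: "integrable lborel (indicator K :: 'a \<Rightarrow> real)"
    using emeasure_bounded_finite[OF compact_imp_bounded[OF assms(2)]]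
    by (intro integrable_real_indicator) auto
  show "integrable lborel (\<lambda>x. indicator K x * u x)"
  proof (rule Bochner_Integration.integrable_bound)
    show "integrable lborel (\<lambda>x. indicator K x + (u x)\<^sup>2)"
      using K u2 by (rule Bochner_Integration.integrable_add)
    have *: "\<bar>t\<bar> \<le> 1 + t\<^sup>2" for t :: real
      using zero_le_power2[of "\<bar>t\<bar> - 1"] abs_ge_zero[of t]
      unfolding power2_diff power2_abs one_power2 by linarith
    have "norm (indicator K x * u x) \<le> norm (indicator K x + (u x)\<^sup>2)" for x
      using order_trans[OF *[of "u x"] abs_ge_self] by (cases "x \<in> K") simp_all
    then show "AE x in lborel. norm (indicator K x * u x) \<le> norm (indicator K x + (u x)\<^sup>2)"
      by (rule AE_I2)
  qed measurable
  show "compact K" by fact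
  show "indicator K y * u y = 0" if "y \<notin> K" for y using that by simp
qed

lemma exterior_fractional_unique_continuation:
  fixes u1 u2 :: "'a::euclidean_space \<Rightarrow> real"
  assumes s: "0 < s" "s < 1" and K: "compact K"
    and W: "open W" "W \<noteq> {}" "W \<inter> K = {}"
    and u1: "u1 \<in> Hs s" "AE x in lborel. x \<notin> K \<longrightarrow> u1 x = 0"
    and u2: "u2 \<in> Hs s" "AE x in lborel. x \<notin> K \<longrightarrow> u2 x = 0"
    and eq: "\<And>\<phi>. test_fun W \<phi> \<Longrightarrow> frac_lap_pair s u1 \<phi> = frac_lap_pair s u2 \<phi>"
  shows "AE x in lborel. u1 x = u2 x"
proof -
  define \<alpha> where "\<alpha> = real DIM('a) + 2 * s"
  \<comment> \<open>The two functions are cut off separately. Each distributional pairing becomes an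
    integral over \<open>K\<close> against a bounded potential, and only these integrals are
    subtracted.\<close>
  interpret v1: compact_density "\<lambda>x. indicator K x * u1 x" K by (rule Hs_compact_density[OF u1(1) K])
  interpret v2: compact_density "\<lambda>x. indicator K x * u2 x" K by (rule Hs_compact_density[OF u2(1) K])
  define w where "w x = indicator K x * u1 x - indicator K x * u2 x" for x
  interpret w: compact_density w K
  proof
    show "compact K" by fact
    show "integrable lborel w"
      unfolding w_def[abs_def]
      by (rule Bochner_Integration.integrable_diff[OF v1.integrable_w v2.integrable_w])
    show "w y = 0" if "y \<notin> K" for y using that by (simp add: w_def)
  qed
  have u: "u1 \<in> borel_measurable borel" "u2 \<in> borel_measurable borel"
    using u1 u2 unfolding Hs_def by auto
  have ae: "AE x in lborel. u1 x = indicator K x * u1 x" "AE x in lborel. u2 x = indicator K x * u2 x"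
    subgoal using u1(2) by eventually_elim (auto simp: indicator_def)
    subgoal using u2(2) by eventually_elim (auto simp: indicator_def)
    done
  have zero: "w.pairing (\<lambda>x. \<integral>y. \<phi> y / dist x y powr \<alpha> \<partial>lborel) = 0" if \<phi>: "test_fun W \<phi>" for \<phi>
  proof -
    let ?G = "\<lambda>x. \<integral>y. \<phi> y / dist x y powr \<alpha> \<partial>lborel"
    have G: "?G \<in> borel_measurable borel"
      by (rule kernel_potential_measurable[OF test_fun_measurable[OF \<phi>]])
    obtain B where B: "\<And>x. x \<in> K \<Longrightarrow> \<bar>?G x\<bar> \<le> B"
      using v1.kernel_potential_bounded[OF W(3) \<phi>] by blast
    have "- frac_const DIM('a) s * v1.pairing ?G = frac_lap_pair s u1 \<phi>"
      unfolding \<alpha>_def by (rule v1.frac_lap_pair_eq_pairing[OF s W(3) \<phi> u(1) ae(1), symmetric])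
    also have "\<dots> = frac_lap_pair s u2 \<phi>" by (rule eq[OF \<phi>])
    also have "\<dots> = - frac_const DIM('a) s * v2.pairing ?G"
      unfolding \<alpha>_def by (rule v2.frac_lap_pair_eq_pairing[OF s W(3) \<phi> u(2) ae(2)])
    finally have "v1.pairing ?G = v2.pairing ?G"
      using frac_const_nonzero[OF s] by (simp only: mult_cancel_left neg_equal_0_iff_equal simp_thms)
    moreover have "w.pairing ?G = v1.pairing ?G - v2.pairing ?G"
    proof -
      have m: "(\<lambda>x. indicator K x * u1 x) \<in> borel_measurable borel" "(\<lambda>x. indicator K x * u2 x) \<in> borel_measurable borel"
        using borel_measurable_integrable[OF v1.integrable_w] borel_measurable_integrable[OF v2.integrable_w] by simp_all
      have i1: "integrable lborel (\<lambda>x. indicator K x * u1 x * ?G x)"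
        by (rule v1.integrable_pairing_bounded[OF borel_measurable_times[OF m(1) G]]) (rule B)
      have i2: "integrable lborel (\<lambda>x. indicator K x * u2 x * ?G x)"
        by (rule v2.integrable_pairing_bounded[OF borel_measurable_times[OF m(2) G]]) (rule B)
      show ?thesis
        unfolding w.pairing_def v1.pairing_def v2.pairing_def w_def left_diff_distrib
        by (rule Bochner_Integration.integral_diff[OF i1 i2])
    qed
    ultimately show ?thesis by simp
  qed
  have kernel: "w.pairing (\<lambda>y. ((x - y) \<bullet> (x - y)) powr (- (\<alpha> / 2))) = 0" if x: "x \<in> W" for x
  proof -
    have "((x - y) \<bullet> (x - y)) powr (- (\<alpha> / 2)) = 1 / dist y x powr \<alpha>" if "y \<in> K" for y
    proof -
      have "dist y x > 0" using x that W(3) by auto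
      then have "(x - y) \<bullet> (x - y) = dist y x powr 2"
        by (simp only: powr_numeral) (metis dist_commute dist_norm power2_norm_eq_inner)
      then have "((x - y) \<bullet> (x - y)) powr (- (\<alpha> / 2)) = dist y x powr (2 * (- (\<alpha> / 2)))"
        by (simp only: powr_powr)
      also have "\<dots> = dist y x powr (- \<alpha>)" by simp
      finally show ?thesis by (simp only: powr_minus_divide)
    qed
    then have "w.pairing (\<lambda>y. ((x - y) \<bullet> (x - y)) powr (- (\<alpha> / 2))) = w.pairing (\<lambda>y. 1 / dist y x powr \<alpha>)"
      by (rule w.pairing_cong)
    also have "\<dots> = 0" by (rule w.pairing_kernel_eq_0[OF W(1,3) _ x]) (rule zero)
    finally show ?thesis .
  qed
  \<comment> \<open>The induction on exponents starts at \<open>\<beta> = \<alpha> / 2\<close>,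
    where \<open>2\<beta> = n + 2s\<close> already exceeds \<open>n\<close>.\<close>
  have \<alpha>: "\<alpha> / 2 > 0" "2 * (\<alpha> / 2) + 2 > real DIM('a)"
    using s(1) \<alpha>_def of_nat_0_le_iff[of "DIM('a)"] DIM_positive[where 'a='a] by linarith+
  obtain x0 where x0: "x0 \<in> W" using W(2) by blast
  have gauss: "w.pairing (\<lambda>y. exp (- ((x - y) \<bullet> (x - y)))) = 0" if "x \<in> W" for x
    by (rule w.pairing_gaussian_eq_0[OF W(1,3) \<alpha> _ that]) (rule kernel)
  have "AE y in lborel. w y = 0"
  proof (rule w.density_AE_eq_0)
    show "w.pairing f = 0" if "continuous_on UNIV f" for f
      by (rule w.pairing_continuous_eq_0[OF W(1) x0 gauss continuous_on_subset[OF that]]) auto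
  qed
  with ae show ?thesis by eventually_elim (auto simp: w_def indicator_def split: if_splits)
qed

theorem theorem3p1:
  fixes \<Omega> W2 :: "'a::euclidean_space set"
    and s :: real
    and F1 F2 :: "('a \<Rightarrow> real) \<Rightarrow> real"
    and u1 u2 :: "'a \<Rightarrow> real"
  assumes dom: "bounded_lipschitz_domain \<Omega>"
    and s: "0 < s" "s < 1"
    and W2: "open W2" "W2 \<noteq> {}" "W2 \<subseteq> - closure \<Omega>"
    and F1: "F1 \<in> Hs_tilde_dual s \<Omega>"
    and F2: "F2 \<in> Hs_tilde_dual s \<Omega>"
    and u1: "u1 \<in> Hs s"
      "\<forall>\<phi>. test_fun \<Omega> \<phi> \<longrightarrow> frac_lap_pair s u1 \<phi> = F1 \<phi>"
      "AE x in lborel. x \<in> - closure \<Omega> \<longrightarrow> u1 x = 0"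
    and u2: "u2 \<in> Hs s"
      "\<forall>\<phi>. test_fun \<Omega> \<phi> \<longrightarrow> frac_lap_pair s u2 \<phi> = F2 \<phi>"
      "AE x in lborel. x \<in> - closure \<Omega> \<longrightarrow> u2 x = 0"
    and eq: "\<forall>\<phi>. test_fun W2 \<phi> \<longrightarrow> frac_lap_pair s u1 \<phi> = frac_lap_pair s u2 \<phi>"
  shows "\<forall>v\<in>Hs_tilde s \<Omega>. F1 v = F2 v"
proof
  have "compact (closure \<Omega>)"
    using dom unfolding bounded_lipschitz_domain_def by (simp add: compact_closure)
  then have ae: "AE x in lborel. u1 x = u2 x"
    using W2 u1 u2 eq
    by (intro exterior_fractional_unique_continuation[OF s, of "closure \<Omega>" W2]) auto
  \<comment> \<open>Inside \<open>\<Omega>\<close> the values of \<open>frac_lap s \<phi>\<close>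
    matter even on the support of \<open>\<phi>\<close>. Measurability is all that is used of them:
    almost everywhere equal solutions then have equal pairings, which are the values of the
    sources.\<close>
  have F: "F1 \<phi> = F2 \<phi>" if \<phi>: "test_fun \<Omega> \<phi>" for \<phi>
  proof -
    obtain M where M: "\<And>x. \<bar>\<phi> x\<bar> \<le> M" using test_fun_bounded[OF \<phi>] by blast
    have [measurable]: "frac_lap s \<phi> \<in> borel_measurable borel"
      by (rule frac_lap_measurable[OF s test_fun_measurable[OF \<phi>] M])
    have [measurable]: "u1 \<in> borel_measurable borel" "u2 \<in> borel_measurable borel"
      using u1 u2 unfolding Hs_def by auto
    have "frac_lap_pair s u1 \<phi> = frac_lap_pair s u2 \<phi>"
      unfolding frac_lap_pair_def
    proof (rule integral_cong_AE)
      show "AE x in lborel. u1 x * frac_lap s \<phi> x = u2 x * frac_lap s \<phi> x"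
        using ae by eventually_elim simp
    qed measurable
    then show ?thesis using u1(2) u2(2) \<phi> by simp
  qed
  fix v assume "v \<in> Hs_tilde s \<Omega>"
  then show "F1 v = F2 v" using Hs_tilde_dual_eqI[OF s F1 F2] F by blast
qed

end
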